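(* Let $G$ be a connected graph with $V(G)=[n]$. Then the following hold: (a) If $G$ is a labeled Hamiltonian graph, then $\operatorname{Min}(I_G)=\{I_X\}$. (b) If $G$ is a labeled semi-Hamiltonian graph, then $\operatorname{Min}(I_G)=\{I_X,(x_2,\ldots,x_n)\}$. In particular, in both cases, $\operatorname{height} I_G=n-1$.
   Context: All graphs are finite and simple. Let $\mathbb{K}$ be a field, $[n]=\{1,\ldots,n\}$ and $S=\mathbb{K}[x_1,\ldots,x_{n+1}]$. For $1\le i<j\le n$ put $g_{ij}=x_ix_{j+1}-x_jx_{i+1}$. For a graph $G$ with vertex set $[n]$, the Hankel edge ideal $I_G\subset S$ is the ideal generated by the $g_{ij}$ with $i<j$ and $\{i,j\}\in E(G)$. $I_X=(g_{ij}:1\le i<j\le n)$ is the ideal of all $2$-minors of the $2\times n$ Hankel matrix $X$ with rows $(x_1,\ldots,x_n)$ and $(x_2,\ldots,x_{n+1})$. $\operatorname{Min}(I)$ denotes the set of minimal prime ideals of $I$. $L_n$ is the path with vertex set $[n]$ and edges $\{i,i+1\}$, $1\le i\le n-1$. $C_n$ is the cycle with vertex set $[n]$ and edges $\{1,n\}$ and $\{i,i+1\}$, $1\le i\le n-1$ (a cycle has at least $3$ vertices). A graph $G$ on $[n]$ is a labeled Hamiltonian graph if $C_n$ is a subgraph of $G$; it is a labeled semi-Hamiltonian graph if $L_n$ is a subgraph of $G$ and $\{1,n\}\notin E(G)$. *)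

theory Defs
  imports
    "HOL-Algebra.Ideal"
    "HOL-Library.Poly_Mapping"
    "HOL-Library.Extended_Nat"
    "Graph_Theory.Digraph_Component"
begin

section \<open>Polynomial rings\<close>

text \<open>
  Polynomials in variables $x_0, x_1, \ldots$ over \<^typ>\<open>'k\<close>: finitely supported functions from
  exponent vectors to coefficients.  The multiplication of \<^type>\<open>poly_mapping\<close> is convolution.
\<close>

type_synonym 'k mpoly = "(nat \<Rightarrow>\<^sub>0 nat) \<Rightarrow>\<^sub>0 'k"

definition X :: "nat \<Rightarrow> 'k::comm_ring_1 mpoly"
  where "X i = Poly_Mapping.single (Poly_Mapping.single i 1) 1"

definition vars :: "'k::zero mpoly \<Rightarrow> nat set"
  where "vars p = (\<Union>m \<in> Poly_Mapping.keys p. Poly_Mapping.keys m)"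

definition poly_ring :: "nat set \<Rightarrow> 'k::comm_ring_1 mpoly ring"
  where "poly_ring V =
    \<lparr>carrier = {p. vars p \<subseteq> V}, monoid.mult = (*), one = 1, zero = 0, add = (+)\<rparr>"

abbreviation S :: "nat \<Rightarrow> 'k::comm_ring_1 mpoly ring"
  where "S n \<equiv> poly_ring {1..n + 1}"

lemma vars_add: "vars (p + q) \<subseteq> vars p \<union> vars q"
  using Poly_Mapping.keys_add[of p q] unfolding vars_def by blast

lemma vars_mult: "vars (p * q) \<subseteq> vars p \<union> vars (q :: 'k::comm_ring_1 mpoly)"
proof
  fix i assume "i \<in> vars (p * q)"
  then obtain m where m: "m \<in> Poly_Mapping.keys (p * q)" "i \<in> Poly_Mapping.keys m"
    by (auto simp: vars_def)
  then obtain a b where "m = a + b" "a \<in> Poly_Mapping.keys p" "b \<in> Poly_Mapping.keys q"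
    using keys_mult[of p q] by blast
  with m Poly_Mapping.keys_add[of a b] show "i \<in> vars p \<union> vars q"
    by (auto simp: vars_def)
qed

lemma vars_uminus: "vars (- p) = vars (p :: 'k::comm_ring_1 mpoly)"
  by (simp add: vars_def)

lemma cring_poly_ring: "cring (poly_ring V :: 'k::comm_ring_1 mpoly ring)"
proof (rule cringI)
  show "abelian_group (poly_ring V :: 'k mpoly ring)"
  proof (rule abelian_groupI)
    fix p :: "'k mpoly" assume "p \<in> carrier (poly_ring V)"
    then show "\<exists>q \<in> carrier (poly_ring V). q \<oplus>\<^bsub>poly_ring V\<^esub> p = \<zero>\<^bsub>poly_ring V\<^esub>"
      by (intro bexI[of _ "- p"]) (auto simp: poly_ring_def vars_uminus)
  next
    fix p q :: "'k mpoly" assume "p \<in> carrier (poly_ring V)" "q \<in> carrier (poly_ring V)"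
    then show "p \<oplus>\<^bsub>poly_ring V\<^esub> q \<in> carrier (poly_ring V)"
      using vars_add[of p q] by (auto simp: poly_ring_def)
  qed (auto simp: poly_ring_def vars_def add.assoc add.commute)
  show "comm_monoid (poly_ring V :: 'k mpoly ring)"
  proof (rule comm_monoidI)
    fix p q :: "'k mpoly" assume "p \<in> carrier (poly_ring V)" "q \<in> carrier (poly_ring V)"
    then show "p \<otimes>\<^bsub>poly_ring V\<^esub> q \<in> carrier (poly_ring V)"
      using vars_mult[of p q] by (auto simp: poly_ring_def)
  qed (auto simp: poly_ring_def vars_def mult.assoc mult.commute)
qed (auto simp: poly_ring_def distrib_right)

lemma X_in_poly_ring: "i \<in> V \<Longrightarrow> X i \<in> carrier (poly_ring V :: 'k::comm_ring_1 mpoly ring)"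
  by (auto simp: X_def poly_ring_def vars_def)


section \<open>Minimal primes and height\<close>

definition minimal_primes :: "('a, 'b) ring_scheme \<Rightarrow> 'a set \<Rightarrow> 'a set set"
  where "minimal_primes R I = {P. primeideal P R \<and> I \<subseteq> P \<and>
    (\<forall>Q. primeideal Q R \<and> I \<subseteq> Q \<and> Q \<subseteq> P \<longrightarrow> Q = P)}"

text \<open>The supremum of the lengths $k$ of chains $P_0 \subset \cdots \subset P_k = P$ of primes.\<close>

definition prime_height :: "('a, 'b) ring_scheme \<Rightarrow> 'a set \<Rightarrow> enat"
  where "prime_height R P = Sup {enat k | k C.
    (\<forall>i \<le> k. primeideal (C i) R) \<and> (\<forall>i < k. C i \<subset> C (Suc i)) \<and> C k = P}"

definition height :: "('a, 'b) ring_scheme \<Rightarrow> 'a set \<Rightarrow> enat"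
  where "height R I = (INF P \<in> {P. primeideal P R \<and> I \<subseteq> P}. prime_height R P)"


section \<open>Graphs on $[n]$\<close>

text \<open>
  A finite simple graph is a \<^locale>\<open>pair_graph\<close>: a finite loop-free digraph with symmetric arc
  relation, an edge $\{i,j\}$ being the two arcs $(i,j)$ and $(j,i)$.
\<close>

definition path_graph :: "nat \<Rightarrow> nat pair_pre_digraph"
  where "path_graph n = \<lparr>pverts = {1..n},
    parcs = {(i, j). i \<in> {1..n} \<and> j \<in> {1..n} \<and> (j = i + 1 \<or> i = j + 1)}\<rparr>"

text \<open>The cycle on $[n]$ only for $n \geq 3$.\<close>

definition cycle_graph :: "nat \<Rightarrow> nat pair_pre_digraph"
  where "cycle_graph n = \<lparr>pverts = {1..n},
    parcs = parcs (path_graph n) \<union> {(1, n), (n, 1)}\<rparr>"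

definition labeled_Hamiltonian :: "nat \<Rightarrow> nat pair_pre_digraph \<Rightarrow> bool"
  where "labeled_Hamiltonian n G \<longleftrightarrow>
    n \<ge> 3 \<and> subgraph (with_proj (cycle_graph n)) (with_proj G)"

definition labeled_semi_Hamiltonian :: "nat \<Rightarrow> nat pair_pre_digraph \<Rightarrow> bool"
  where "labeled_semi_Hamiltonian n G \<longleftrightarrow>
    subgraph (with_proj (path_graph n)) (with_proj G) \<and> (1, n) \<notin> parcs G"

lemma pair_graph_path_graph: "pair_graph (path_graph n)"
proof -
  have "finite (parcs (path_graph n))"
    by (rule finite_subset[of _ "{1..n} \<times> {1..n}"]) (auto simp: path_graph_def)
  then show ?thesis
    by unfold_locales (auto simp: path_graph_def symmetric_def sym_def)
qed

lemma pair_graph_cycle_graph: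
  assumes "n \<ge> 3"
  shows "pair_graph (cycle_graph n)"
proof -
  have "finite (parcs (cycle_graph n))"
    by (rule finite_subset[of _ "{1..n} \<times> {1..n}"])
       (use assms in \<open>auto simp: cycle_graph_def path_graph_def\<close>)
  then show ?thesis
    using assms by unfold_locales (auto simp: cycle_graph_def path_graph_def symmetric_def sym_def)
qed


section \<open>Hankel edge ideals\<close>

definition hankel_minor :: "nat \<Rightarrow> nat \<Rightarrow> 'k::comm_ring_1 mpoly"
  where "hankel_minor i j = X i * X (j + 1) - X j * X (i + 1)"

definition hankel_edge_ideal :: "nat \<Rightarrow> nat pair_pre_digraph \<Rightarrow> 'k::comm_ring_1 mpoly set"
  where "hankel_edge_ideal n G = Idl\<^bsub>S n\<^esub> {hankel_minor i j | i j. i < j \<and> (i, j) \<in> parcs G}"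

definition hankel_ideal :: "nat \<Rightarrow> 'k::comm_ring_1 mpoly set"
  where "hankel_ideal n = Idl\<^bsub>S n\<^esub> {hankel_minor i j | i j. 1 \<le> i \<and> i < j \<and> j \<le> n}"

end

theory Submission
  imports Defs "HOL-Library.FuncSet" "HOL-Library.Multiset"
begin

text \<open>
  A prime $P$ containing the minors $x_{i-1} x_{i+1} - x_i^2$ of the path either contains some
  variable, and then all of $x_2, \ldots, x_n$, or it contains none; in the latter case consecutive
  ratios $x_{i+1} / x_i$ agree modulo $P$, so all minors lie in $P$.  The edge $\{1, n\}$ decides
  whether $(x_2, \ldots, x_n)$ contains $I_G$ or contributes nothing new.  Primality of $I_X$ is
  its description as the kernel of $x_i \mapsto s t^i$.

  For the heights, explicit chains give the lower bound $n - 1$.  Conversely, a chain of primes below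
  $I_X$ extends by $(x_1, \ldots, x_n) \subset (x_1, \ldots, x_{n+1})$, and chains in $S$ have
  length at most $n + 1$: choosing $f_i \in P_i \setminus P_{i-1}$ along a chain gives
  algebraically independent polynomials.
\<close>

section \<open>Substitution homomorphisms\<close>

text \<open>Every prime exhibited below, namely I_X, the ideals generated by variables and the
  members of the explicit chains, is obtained as the kernel of a substitution into a domain.
  Primality is then immediate, and the work lies in showing that a kernel is generated by the
  expected polynomials. The parameters s and t are the variables \<open>X 0\<close> and
  \<open>X 1\<close> of the same polynomial type; substitution is simultaneous, so t may share its
  name with x_1. Since \<open>height\<close> is an infimum over all primes above I_G, its upper
  bound needs only the single prime I_X, whereas its lower bound concerns each of these primes. Two
  chains suffice for it, because every such prime contains I_X or (x_2,...,x_n). For n = 1 the two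
  ideals of (b) are both zero and the pair is a singleton; for n = 2 the edge {1,2} of the path is
  {1,n}, so (b) is vacuous.\<close>

lemma poly_mapping_expand: "(\<Sum>m\<in>Poly_Mapping.keys p. Poly_Mapping.single m (Poly_Mapping.lookup p m)) = p"
proof (rule poly_mapping_eqI)
  fix k
  have "(\<Sum>m\<in>Poly_Mapping.keys p. Poly_Mapping.lookup (Poly_Mapping.single m (Poly_Mapping.lookup p m)) k)
      = (\<Sum>m\<in>Poly_Mapping.keys p. if m = k then Poly_Mapping.lookup p m else 0)"
    by (intro sum.cong) (auto simp: lookup_single when_def)
  also have "\<dots> = Poly_Mapping.lookup p k"
    by (auto simp: sum.delta in_keys_iff)
  finally show "Poly_Mapping.lookup (\<Sum>m\<in>Poly_Mapping.keys p. Poly_Mapping.single m (Poly_Mapping.lookup p m)) k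
      = Poly_Mapping.lookup p k"
    by (simp add: lookup_sum)
qed

definition power_prod :: "(nat \<Rightarrow> 'b::comm_monoid_mult) \<Rightarrow> (nat \<Rightarrow>\<^sub>0 nat) \<Rightarrow> 'b"
  where "power_prod f m = (\<Prod>i\<in>Poly_Mapping.keys m. f i ^ Poly_Mapping.lookup m i)"

lemma power_prod_superset:
  assumes "finite A" "Poly_Mapping.keys m \<subseteq> A"
  shows "power_prod f m = (\<Prod>i\<in>A. f i ^ Poly_Mapping.lookup m i)"
  unfolding power_prod_def
  by (rule prod.mono_neutral_left) (use assms in \<open>auto simp: in_keys_iff\<close>)

lemma power_prod_0 [simp]: "power_prod f 0 = 1"
  by (simp add: power_prod_def)

lemma power_prod_single [simp]: "power_prod f (Poly_Mapping.single i e) = f i ^ e"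
  by (simp add: power_prod_def)

lemma power_prod_add: "power_prod f (a + b) = power_prod f a * power_prod f b"
proof -
  let ?A = "Poly_Mapping.keys a \<union> Poly_Mapping.keys b"
  have "power_prod f (a + b) = (\<Prod>i\<in>?A. f i ^ Poly_Mapping.lookup (a + b) i)"
    by (rule power_prod_superset) (auto dest: subsetD[OF Poly_Mapping.keys_add])
  also have "\<dots> = (\<Prod>i\<in>?A. f i ^ Poly_Mapping.lookup a i) * (\<Prod>i\<in>?A. f i ^ Poly_Mapping.lookup b i)"
    by (simp add: lookup_add power_add prod.distrib)
  finally show ?thesis
    by (simp add: power_prod_superset[of ?A])
qed

lemma X_power: "X i ^ e = (Poly_Mapping.single (Poly_Mapping.single i e) 1 :: 'k::comm_ring_1 mpoly)"
  by (induction e) (simp_all add: X_def mult_single flip: single_add)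

lemma single_eq_power_prod: "Poly_Mapping.single m 1 = (power_prod X m :: 'k::comm_ring_1 mpoly)"
proof -
  have "Poly_Mapping.single (\<Sum>i\<in>A. Poly_Mapping.single i (Poly_Mapping.lookup m i)) 1
      = (\<Prod>i\<in>A. X i ^ Poly_Mapping.lookup m i :: 'k mpoly)" if "finite A" for A
    using that
  proof (induction A)
    case (insert i A)
    then show ?case
      using mult_single[of "Poly_Mapping.single i (Poly_Mapping.lookup m i)" "1 :: 'k"
          "\<Sum>i\<in>A. Poly_Mapping.single i (Poly_Mapping.lookup m i)" 1]
      by (simp add: X_power)
  qed simp
  from this[of "Poly_Mapping.keys m"] show ?thesis
    by (simp add: poly_mapping_expand power_prod_def)
qed

lemma single_eq_const_mult: "Poly_Mapping.single m c = (Poly_Mapping.single 0 c * power_prod X m :: 'k::comm_ring_1 mpoly)"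
  by (simp add: mult_single flip: single_eq_power_prod)

lemma X_ne_0 [simp]: "X i \<noteq> (0 :: 'k::comm_ring_1 mpoly)"
proof
  assume "X i = (0 :: 'k mpoly)"
  then have "Poly_Mapping.lookup (X i :: 'k mpoly) (Poly_Mapping.single i 1) = 0"
    by simp
  then show False by (simp add: X_def)
qed

lemma vars_const [simp]: "vars (Poly_Mapping.single 0 c) = {}"
  by (simp add: vars_def)

lemma vars_X [simp]: "vars (X i :: 'k::comm_ring_1 mpoly) = {i}"
  by (simp add: vars_def X_def)

lemma vars_0 [simp]: "vars 0 = {}"
  by (simp add: vars_def)

lemma vars_1 [simp]: "vars (1 :: 'k::comm_ring_1 mpoly) = {}"
  by (simp add: vars_def)

lemma vars_diff: "vars (p - q) \<subseteq> vars p \<union> vars (q :: 'k::comm_ring_1 mpoly)"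
  using vars_add[of p "- q"] by (simp add: vars_uminus)

lemma vars_closed:
  fixes p q :: "'k::comm_ring_1 mpoly"
  assumes "vars p \<subseteq> V"
  shows vars_add_closed: "vars q \<subseteq> V \<Longrightarrow> vars (p + q) \<subseteq> V"
    and vars_diff_closed: "vars q \<subseteq> V \<Longrightarrow> vars (p - q) \<subseteq> V"
    and vars_mult_closed: "vars q \<subseteq> V \<Longrightarrow> vars (p * q) \<subseteq> V"
    and vars_power_closed: "vars (p ^ e) \<subseteq> V"
proof -
  show "vars q \<subseteq> V \<Longrightarrow> vars (p + q) \<subseteq> V" "vars q \<subseteq> V \<Longrightarrow> vars (p - q) \<subseteq> V"
    "vars q \<subseteq> V \<Longrightarrow> vars (p * q) \<subseteq> V"
    using assms vars_add[of p q] vars_diff[of p q] vars_mult[of p q] by blast+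
  show "vars (p ^ e) \<subseteq> V"
  proof (induction e)
    case (Suc e)
    with assms vars_mult[of p "p ^ e"] show ?case by auto
  qed simp
qed

lemma vars_sum_closed:
  fixes g :: "'a \<Rightarrow> 'k::comm_ring_1 mpoly"
  assumes "\<And>a. a \<in> A \<Longrightarrow> vars (g a) \<subseteq> V"
  shows "vars (sum g A) \<subseteq> V"
  using assms by (induction A rule: infinite_finite_induct) (simp_all add: vars_add_closed)

lemma vars_single_subset: "vars (Poly_Mapping.single m c) \<subseteq> Poly_Mapping.keys m"
  by (simp add: vars_def)

text \<open>Lets identities between ring homomorphisms be checked on constants and variables only.
  Restricting the variable case to \<open>V\<close> permits hypotheses on a substitution that hold
  only on \<open>V\<close>.\<close>

lemma mpoly_induct [consumes 1, case_names const var add mult]: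
  fixes p :: "'k::comm_ring_1 mpoly"
  assumes "vars p \<subseteq> V"
    and const: "\<And>c. Q (Poly_Mapping.single 0 c)"
    and var: "\<And>i. i \<in> V \<Longrightarrow> Q (X i)"
    and add: "\<And>p q. Q p \<Longrightarrow> Q q \<Longrightarrow> Q (p + q)"
    and mult: "\<And>p q. Q p \<Longrightarrow> Q q \<Longrightarrow> Q (p * q)"
  shows "Q p"
proof -
  have Q01: "Q 0" "Q 1"
    using const[of 0] const[of 1] by simp_all
  have pow: "Q (q ^ e)" if "Q q" for q e
    using that by (induction e) (auto intro: mult Q01)
  have pp: "Q (power_prod X m)" if "Poly_Mapping.keys m \<subseteq> V" for m
  proof -
    have "Q (\<Prod>i\<in>A. X i ^ Poly_Mapping.lookup m i)" if "finite A" "A \<subseteq> V" for A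
      using that by (induction A) (auto intro!: mult Q01 pow var)
    with that show ?thesis by (simp add: power_prod_def)
  qed
  have "Q (\<Sum>m\<in>M. Poly_Mapping.single m (Poly_Mapping.lookup p m))"
    if "finite M" "M \<subseteq> Poly_Mapping.keys p" for M
    using that
  proof (induction M)
    case (insert m M)
    then have "Poly_Mapping.keys m \<subseteq> V"
      using assms(1) by (auto simp: vars_def)
    then have "Q (Poly_Mapping.single m (Poly_Mapping.lookup p m))"
      unfolding single_eq_const_mult[of m] by (intro mult const pp)
    with insert show ?case
      by (auto intro: add)
  qed (simp add: Q01)
  from this[of "Poly_Mapping.keys p"] show ?thesis
    by (simp add: poly_mapping_expand)
qed

definition msubst :: "(nat \<Rightarrow> 'k mpoly) \<Rightarrow> 'k mpoly \<Rightarrow> 'k::comm_ring_1 mpoly"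
  where "msubst f p =
    (\<Sum>m\<in>Poly_Mapping.keys p. Poly_Mapping.single 0 (Poly_Mapping.lookup p m) * power_prod f m)"

lemma msubst_add: "msubst f (p + q) = msubst f p + msubst f q"
  unfolding msubst_def
  by (rule setsum_keys_plus_distrib) (simp_all add: single_add distrib_right)

lemma msubst_0 [simp]: "msubst f 0 = 0"
  by (simp add: msubst_def)

lemma msubst_sum: "msubst f (sum g A) = (\<Sum>a\<in>A. msubst f (g a))"
  by (induction A rule: infinite_finite_induct) (simp_all add: msubst_add)

lemma msubst_uminus: "msubst f (- p) = - msubst f p"
  using msubst_add[of f p "- p"] by (simp add: eq_neg_iff_add_eq_0 add.commute)

lemma msubst_diff: "msubst f (p - q) = msubst f p - msubst f q"
  using msubst_add[of f p "- q"] by (simp add: msubst_uminus)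

lemma msubst_single: "msubst f (Poly_Mapping.single m c) = Poly_Mapping.single 0 c * power_prod f m"
  by (cases "c = 0") (simp_all add: msubst_def)

lemma msubst_const [simp]: "msubst f (Poly_Mapping.single 0 c) = Poly_Mapping.single 0 c"
  by (simp add: msubst_single)

lemma msubst_1 [simp]: "msubst f 1 = 1"
  using msubst_const[of f 1] by simp

lemma msubst_X [simp]: "msubst f (X i) = f i"
  by (simp add: X_def msubst_single)

text \<open>Both sides are additive in \<open>p\<close> and in \<open>q\<close>, so expansion into
  terms leaves a product of two single terms, where \<open>power_prod_add\<close> applies.\<close>

lemma msubst_mult: "msubst f (p * q) = msubst f p * msubst f q"
proof -
  let ?P = "\<lambda>m. Poly_Mapping.single m (Poly_Mapping.lookup p m)"
  let ?Q = "\<lambda>m. Poly_Mapping.single m (Poly_Mapping.lookup q m)"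
  have single: "msubst f (Poly_Mapping.single a c * Poly_Mapping.single b d)
      = msubst f (Poly_Mapping.single a c) * msubst f (Poly_Mapping.single b d)" for a b c d
  proof -
    have "Poly_Mapping.single 0 (c * d) = (Poly_Mapping.single 0 c * Poly_Mapping.single 0 d :: 'a mpoly)"
      by (simp add: mult_single)
    then show ?thesis
      by (simp only: mult_single[of a c b d] msubst_single power_prod_add mult.assoc mult.left_commute)
  qed
  have "msubst f (sum ?P (Poly_Mapping.keys p) * sum ?Q (Poly_Mapping.keys q))
      = msubst f (sum ?P (Poly_Mapping.keys p)) * msubst f (sum ?Q (Poly_Mapping.keys q))"
    by (simp add: sum_product msubst_sum single)
  then show ?thesis by (simp add: poly_mapping_expand)
qed

lemma msubst_power: "msubst f (p ^ e) = msubst f p ^ e"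
  by (induction e) (simp_all add: msubst_mult)

lemmas msubst_simps = msubst_add msubst_uminus msubst_diff msubst_mult msubst_power

lemma msubst_msubst: "msubst g (msubst f p) = msubst (\<lambda>i. msubst g (f i)) p"
  using subset_UNIV[of "vars p"] by (induction p rule: mpoly_induct) (simp_all add: msubst_simps)

lemma msubst_cong:
  assumes "vars p \<subseteq> V" "\<And>i. i \<in> V \<Longrightarrow> f i = g i"
  shows "msubst f p = msubst g p"
  using assms(1) by (induction p rule: mpoly_induct) (simp_all add: msubst_simps assms(2))

lemma vars_msubst:
  assumes "vars p \<subseteq> V" "\<And>i. i \<in> V \<Longrightarrow> vars (f i) \<subseteq> W"
  shows "vars (msubst f p) \<subseteq> W"
  using assms(1)
  by (induction p rule: mpoly_induct) (simp_all add: assms(2) msubst_simps vars_closed)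


section \<open>Ideals of the polynomial ring\<close>

lemma poly_ring_simps [simp]:
  "p \<in> carrier (poly_ring V) \<longleftrightarrow> vars p \<subseteq> V"
  "p \<otimes>\<^bsub>poly_ring V\<^esub> q = p * q" "p \<oplus>\<^bsub>poly_ring V\<^esub> q = p + q"
  "\<one>\<^bsub>poly_ring V\<^esub> = 1" "\<zero>\<^bsub>poly_ring V\<^esub> = 0"
  by (simp_all add: poly_ring_def)

lemma ring_poly_ring: "ring (poly_ring V :: 'k::comm_ring_1 mpoly ring)"
  using cring_poly_ring by (rule cring.axioms(1))

lemma poly_ring_a_inv:
  assumes "vars (p :: 'k::comm_ring_1 mpoly) \<subseteq> V"
  shows "\<ominus>\<^bsub>poly_ring V\<^esub> p = - p"
proof -
  interpret ring "poly_ring V :: 'k mpoly ring" by (rule ring_poly_ring)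
  show ?thesis
    using assms by (intro minus_equality) (simp_all add: vars_uminus)
qed

text \<open>Replaces the record operations by those of the type, so that ideal membership can be
  argued with ordinary algebra. Closure under negation comes from multiplication by -1.\<close>

lemma poly_ideal_iff:
  fixes J :: "'k::comm_ring_1 mpoly set"
  shows "ideal J (poly_ring V) \<longleftrightarrow> (\<forall>p\<in>J. vars p \<subseteq> V) \<and> 0 \<in> J \<and>
    (\<forall>p\<in>J. \<forall>q\<in>J. p + q \<in> J) \<and> (\<forall>p\<in>J. \<forall>r. vars r \<subseteq> V \<longrightarrow> r * p \<in> J)" (is "_ \<longleftrightarrow> ?rhs")
proof
  assume "ideal J (poly_ring V)"
  then interpret ideal J "poly_ring V :: 'k mpoly ring" .
  show ?rhs
    using a_subset additive_subgroup.zero_closed[OF is_additive_subgroup]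
      additive_subgroup.a_closed[OF is_additive_subgroup] I_l_closed
    by (simp add: subset_iff)
next
  assume J: ?rhs
  have neg: "- p \<in> J" if "p \<in> J" for p
    using J that by (metis mult_minus1 vars_1 vars_uminus empty_subsetI)
  interpret ring "poly_ring V :: 'k mpoly ring" by (rule ring_poly_ring)
  show "ideal J (poly_ring V)"
  proof (rule idealI)
    show "subgroup J (add_monoid (poly_ring V))"
      using J neg poly_ring_a_inv[of _ V]
      by (intro add.subgroupI) (auto simp: poly_ring_a_inv)
  qed (use J in \<open>auto simp: ring_poly_ring mult.commute\<close>)
qed

lemma poly_ideal_closed:
  fixes J :: "'k::comm_ring_1 mpoly set"
  assumes "ideal J (poly_ring V)"
  shows poly_ideal_vars: "p \<in> J \<Longrightarrow> vars p \<subseteq> V"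
    and poly_ideal_0: "0 \<in> J"
    and poly_ideal_add: "p \<in> J \<Longrightarrow> q \<in> J \<Longrightarrow> p + q \<in> J"
    and poly_ideal_mult: "p \<in> J \<Longrightarrow> vars r \<subseteq> V \<Longrightarrow> r * p \<in> J"
    and poly_ideal_mult_right: "p \<in> J \<Longrightarrow> vars r \<subseteq> V \<Longrightarrow> p * r \<in> J"
    and poly_ideal_uminus: "p \<in> J \<Longrightarrow> - p \<in> J"
    and poly_ideal_diff: "p \<in> J \<Longrightarrow> q \<in> J \<Longrightarrow> p - q \<in> J"
proof -
  note J = assms[unfolded poly_ideal_iff]
  show "p \<in> J \<Longrightarrow> vars p \<subseteq> V" "0 \<in> J" "p \<in> J \<Longrightarrow> q \<in> J \<Longrightarrow> p + q \<in> J"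
    "p \<in> J \<Longrightarrow> vars r \<subseteq> V \<Longrightarrow> r * p \<in> J" "p \<in> J \<Longrightarrow> vars r \<subseteq> V \<Longrightarrow> p * r \<in> J"
    using J by (auto simp: mult.commute)
  show neg: "- p \<in> J" if "p \<in> J" for p
    using J that by (metis mult_minus1 vars_1 vars_uminus empty_subsetI)
  show "p - q \<in> J" if "p \<in> J" "q \<in> J"
    using J that(1) neg[OF that(2)] by (metis uminus_add_conv_diff add.commute)
qed

lemma poly_prime_iff:
  fixes P :: "'k::comm_ring_1 mpoly set"
  shows "primeideal P (poly_ring V) \<longleftrightarrow> ideal P (poly_ring V) \<and> 1 \<notin> P \<and>
    (\<forall>p q. vars p \<subseteq> V \<longrightarrow> vars q \<subseteq> V \<longrightarrow> p * q \<in> P \<longrightarrow> p \<in> P \<or> q \<in> P)" (is "_ \<longleftrightarrow> ?rhs")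
proof
  assume "primeideal P (poly_ring V)"
  then interpret primeideal P "poly_ring V :: 'k mpoly ring" .
  show ?rhs
    using is_ideal one_imp_carrier I_notcarr I_prime by auto
next
  assume P: ?rhs
  then have "carrier (poly_ring V) \<noteq> P"
    by (metis poly_ring_simps(1) vars_1 empty_subsetI)
  with P show "primeideal P (poly_ring V)"
    by (intro primeidealI cring_poly_ring) auto
qed

lemma poly_prime_power:
  assumes "primeideal P (poly_ring V)" "vars p \<subseteq> V" "p ^ e \<in> (P :: 'k::comm_ring_1 mpoly set)"
  shows "p \<in> P"
  using assms(3)
proof (induction e)
  case (Suc e)
  with assms(1,2) show ?case
    unfolding poly_prime_iff power_Suc by (metis vars_power_closed)
qed (use assms(1) in \<open>simp add: poly_prime_iff\<close>)

lemma genideal_poly_ring: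
  fixes B :: "'k::comm_ring_1 mpoly set"
  assumes "\<And>b. b \<in> B \<Longrightarrow> vars b \<subseteq> V"
  shows ideal_genideal_poly: "ideal (Idl\<^bsub>poly_ring V\<^esub> B) (poly_ring V)"
    and genideal_poly_self: "b \<in> B \<Longrightarrow> b \<in> Idl\<^bsub>poly_ring V\<^esub> B"
    and genideal_poly_subset_iff: "ideal J (poly_ring V) \<Longrightarrow> Idl\<^bsub>poly_ring V\<^esub> B \<subseteq> J \<longleftrightarrow> B \<subseteq> J"
proof -
  interpret ring "poly_ring V :: 'k mpoly ring" by (rule ring_poly_ring)
  have B: "B \<subseteq> carrier (poly_ring V)" using assms by auto
  show "ideal (Idl\<^bsub>poly_ring V\<^esub> B) (poly_ring V)" "b \<in> B \<Longrightarrow> b \<in> Idl\<^bsub>poly_ring V\<^esub> B"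
    using genideal_ideal[OF B] genideal_self[OF B] by auto
  show "ideal J (poly_ring V) \<Longrightarrow> Idl\<^bsub>poly_ring V\<^esub> B \<subseteq> J \<longleftrightarrow> B \<subseteq> J"
    using genideal_minimal[of J B] genideal_self[OF B] by auto
qed

section \<open>Kernels of substitutions, and ideals generated by variables\<close>

definition msubst_kernel :: "nat set \<Rightarrow> (nat \<Rightarrow> 'k mpoly) \<Rightarrow> 'k::field mpoly set"
  where "msubst_kernel V f = {p. vars p \<subseteq> V \<and> msubst f p = 0}"

text \<open>Polynomials over a field form an integral domain, so a product with image 0 has a factor
  with image 0; and 1 is sent to 1.\<close>

lemma primeideal_msubst_kernel: "primeideal (msubst_kernel V f) (poly_ring V)"
proof -
  have "ideal (msubst_kernel V f) (poly_ring V)"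
    by (simp add: poly_ideal_iff msubst_kernel_def msubst_simps vars_closed)
  then show ?thesis
    by (auto simp: poly_prime_iff msubst_kernel_def msubst_simps)
qed

text \<open>Setting the variables of \<open>A\<close> to zero changes a polynomial only by an
  element of the ideal; a polynomial that becomes zero therefore lies in the ideal itself.\<close>

lemma variable_ideal_eq_kernel:
  assumes "A \<subseteq> V"
  shows "Idl\<^bsub>poly_ring V\<^esub> (X ` A) = msubst_kernel V (\<lambda>i. if i \<in> A then 0 else X i :: 'k::field mpoly)"
    (is "?I = msubst_kernel V ?f")
proof
  have XA: "vars b \<subseteq> V" if "b \<in> X ` A" for b :: "'k mpoly"
    using that assms by auto
  note I = ideal_genideal_poly[of "X ` A" V, OF XA]
  show "?I \<subseteq> msubst_kernel V ?f"
    using genideal_poly_subset_iff[of "X ` A" V "msubst_kernel V ?f", OF XA] assms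
      primeideal_msubst_kernel[of V ?f]
    by (auto simp: msubst_kernel_def poly_prime_iff)
  \<comment> \<open>The bounds on the variables are carried along because the ideal absorbs only
    multipliers from \<open>poly_ring V\<close>, and the product case multiplies by \<open>q\<close>
    and by \<open>msubst ?f p\<close>.\<close>
  have "p - msubst ?f p \<in> ?I \<and> vars p \<subseteq> V \<and> vars (msubst ?f p) \<subseteq> V" if "vars p \<subseteq> V" for p :: "'k mpoly"
    using that
  proof (induction p rule: mpoly_induct)
    case (const c)
    show ?case using poly_ideal_0[OF I] by simp
  next
    case (var i)
    then show ?case
      using genideal_poly_self[of "X ` A" V "X i", OF XA] poly_ideal_0[OF I] by simp
  next
    case (add p q)
    have "p + q - msubst ?f (p + q) = (p - msubst ?f p) + (q - msubst ?f q)"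
      by (simp add: msubst_simps)
    also have "\<dots> \<in> ?I"
      using add by (intro poly_ideal_add[OF I]) auto
    finally show ?case
      using add by (simp add: msubst_simps vars_closed)
  next
    case (mult p q)
    have "p * q - msubst ?f (p * q) = (p - msubst ?f p) * q + msubst ?f p * (q - msubst ?f q)"
      by (simp add: msubst_simps algebra_simps)
    also have "\<dots> \<in> ?I"
      using mult by (intro poly_ideal_add[OF I] poly_ideal_mult[OF I] poly_ideal_mult_right[OF I]) auto
    finally show ?case
      using mult by (simp add: msubst_simps vars_closed)
  qed
  then show "msubst_kernel V ?f \<subseteq> ?I"
    by (fastforce simp: msubst_kernel_def)
qed

lemma primeideal_variable_ideal:
  assumes "A \<subseteq> V"
  shows "primeideal (Idl\<^bsub>poly_ring V\<^esub> (X ` A) :: 'k::field mpoly set) (poly_ring V)"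
  unfolding variable_ideal_eq_kernel[OF assms] by (rule primeideal_msubst_kernel)

lemma variable_ideal_subset_iff:
  assumes "A \<subseteq> V" "ideal J (poly_ring V)"
  shows "Idl\<^bsub>poly_ring V\<^esub> (X ` A) \<subseteq> J \<longleftrightarrow> (\<forall>i\<in>A. X i \<in> (J :: 'k::field mpoly set))"
  using assms by (subst genideal_poly_subset_iff) auto

lemma X_mem_variable_ideal_iff:
  assumes "A \<subseteq> V" "i \<in> V"
  shows "(X i :: 'k::field mpoly) \<in> Idl\<^bsub>poly_ring V\<^esub> (X ` A) \<longleftrightarrow> i \<in> A"
  using assms by (auto simp: variable_ideal_eq_kernel msubst_kernel_def)

lemma variable_ideal_mono:
  assumes "A \<subseteq> B" "B \<subseteq> V"
  shows "Idl\<^bsub>poly_ring V\<^esub> (X ` A) \<subseteq> (Idl\<^bsub>poly_ring V\<^esub> (X ` B) :: 'k::field mpoly set)"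
proof (subst variable_ideal_subset_iff)
  show "ideal (Idl\<^bsub>poly_ring V\<^esub> (X ` B) :: 'k mpoly set) (poly_ring V)"
    by (rule primeideal.axioms(1)[OF primeideal_variable_ideal[OF assms(2)]])
qed (use assms X_mem_variable_ideal_iff in blast)+

lemma variable_ideal_psubset:
  assumes "A \<subset> B" "B \<subseteq> V"
  shows "Idl\<^bsub>poly_ring V\<^esub> (X ` A) \<subset> (Idl\<^bsub>poly_ring V\<^esub> (X ` B) :: 'k::field mpoly set)"
proof -
  obtain i where i: "i \<in> B" "i \<notin> A" using assms(1) by blast
  have "(X i :: 'k mpoly) \<in> Idl\<^bsub>poly_ring V\<^esub> (X ` B)" "(X i :: 'k mpoly) \<notin> Idl\<^bsub>poly_ring V\<^esub> (X ` A)"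
    using i assms by (simp_all add: X_mem_variable_ideal_iff subset_iff psubset_eq)
  with variable_ideal_mono[of A B V, where ?'k = 'k] assms show ?thesis by blast
qed


section \<open>The dimension of the polynomial ring\<close>

text \<open>Division by \<open>X i\<close> with a remainder free of \<open>X i\<close>. The last
  clause makes the exponents of \<open>X i\<close> in \<open>q\<close> drop by one, which is the
  termination measure of the induction that uses it.\<close>

lemma split_variable:
  fixes p :: "'k::comm_ring_1 mpoly"
  obtains p0 q where "p = p0 + X i * q" "vars p0 \<subseteq> vars p - {i}" "vars q \<subseteq> vars p"
    "\<And>m. m \<in> Poly_Mapping.keys q \<Longrightarrow> m + Poly_Mapping.single i 1 \<in> Poly_Mapping.keys p"
proof -
  let ?K = "Poly_Mapping.keys p"
  let ?x = "Poly_Mapping.single i (1::nat)"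
  let ?t = "\<lambda>m. Poly_Mapping.single m (Poly_Mapping.lookup p m)"
  define K0 where "K0 = {m\<in>?K. Poly_Mapping.lookup m i = 0}"
  define K1 where "K1 = {m\<in>?K. Poly_Mapping.lookup m i \<noteq> 0}"
  define q where "q = (\<Sum>m\<in>K1. Poly_Mapping.single (m - ?x) (Poly_Mapping.lookup p m))"
  \<comment> \<open>Subtraction of exponents is truncated; on \<open>K1\<close> the exponent of
    \<open>i\<close> is positive, so nothing is lost.\<close>
  have restore: "m - ?x + ?x = m" if "m \<in> K1" for m
    using that by (intro poly_mapping_eqI) (auto simp: K1_def lookup_add lookup_minus lookup_single when_def)
  have fin: "finite K0" "finite K1" by (auto simp: K0_def K1_def)
  have "K0 \<union> K1 = ?K" by (auto simp: K0_def K1_def)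
  then have "p = sum ?t (K0 \<union> K1)"
    by (simp add: poly_mapping_expand)
  also have "\<dots> = sum ?t K0 + sum ?t K1"
    using fin by (intro sum.union_disjoint) (auto simp: K0_def K1_def)
  also have "sum ?t K1 = X i * q"
    unfolding q_def sum_distrib_left
    by (intro sum.cong refl) (use restore in \<open>simp add: X_def mult_single add.commute\<close>)
  finally have p: "p = sum ?t K0 + X i * q" .
  have K0: "Poly_Mapping.keys (sum ?t K0) \<subseteq> K0"
    using keys_sum[of ?t K0] by (auto split: if_splits)
  have q: "\<exists>m'\<in>K1. m = m' - ?x" if "m \<in> Poly_Mapping.keys q" for m
    using that keys_sum[of "\<lambda>m. Poly_Mapping.single (m - ?x) (Poly_Mapping.lookup p m)" K1]
    by (auto simp: q_def split: if_splits)
  have keys_q: "m + ?x \<in> ?K" if "m \<in> Poly_Mapping.keys q" for m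
    using q[OF that] restore by (auto simp: K1_def)
  show thesis
  proof
    show "p = sum ?t K0 + X i * q" by fact
    show "vars (sum ?t K0) \<subseteq> vars p - {i}"
    proof
      fix j assume "j \<in> vars (sum ?t K0)"
      then obtain m where "m \<in> K0" "j \<in> Poly_Mapping.keys m"
        using K0 by (auto simp: vars_def)
      then show "j \<in> vars p - {i}"
        by (auto simp: vars_def K0_def in_keys_iff)
    qed
    show "vars q \<subseteq> vars p"
    proof
      fix j assume "j \<in> vars q"
      then obtain m where "m \<in> Poly_Mapping.keys q" "j \<in> Poly_Mapping.keys m"
        by (auto simp: vars_def)
      with keys_q[of m] show "j \<in> vars p"
        unfolding vars_def by (intro UN_I[of "m + ?x"]) (simp_all add: in_keys_iff lookup_add)
    qed
    show "m + ?x \<in> ?K" if "m \<in> Poly_Mapping.keys q" for m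
      using keys_q[OF that] .
  qed
qed

text \<open>The general \<open>j\<close> makes a downward induction possible: \<open>f j\<close>,
  ..., \<open>f (k - 1)\<close> are independent modulo \<open>C j\<close>. For \<open>j = k\<close>
  only constants remain, and \<open>C k\<close> is proper. In the step, write p = p0 + x_j q; modulo
  \<open>C (Suc j)\<close> only p0 survives, so p0 = 0, and primality of \<open>C j\<close> cancels
  the factor \<open>f j\<close>.\<close>

lemma chain_algebraically_independent:
  fixes C :: "nat \<Rightarrow> 'k::field mpoly set"
  assumes prime: "\<And>i. i \<le> k \<Longrightarrow> primeideal (C i) (poly_ring V)"
    and chain: "\<And>i. i < k \<Longrightarrow> C i \<subseteq> C (Suc i)"
    and f: "\<And>i. i < k \<Longrightarrow> f i \<in> C (Suc i)" "\<And>i. i < k \<Longrightarrow> f i \<notin> C i"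
    and "j \<le> k" "vars p \<subseteq> {j..<k}" "msubst f p \<in> C j"
  shows "p = 0"
  using assms(5-7)
proof (induction j arbitrary: p rule: inc_induct)
  case base
  have "p = Poly_Mapping.single 0 (Poly_Mapping.lookup p 0)"
  proof (rule poly_mapping_eqI)
    fix m
    show "Poly_Mapping.lookup p m = Poly_Mapping.lookup (Poly_Mapping.single 0 (Poly_Mapping.lookup p 0)) m"
    proof (cases "m \<in> Poly_Mapping.keys p")
      case True
      then have "m = 0"
        using base(1) by (auto simp: vars_def)
      then show ?thesis by simp
    qed (auto simp: in_keys_iff lookup_single when_def)
  qed
  then obtain c where p: "p = Poly_Mapping.single 0 c" by blast
  show ?case
  proof (rule ccontr)
    assume "p \<noteq> 0"
    then have "c \<noteq> 0" using p by auto
    then have "Poly_Mapping.single 0 (1 / c) * msubst f p = 1"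
      using p by (simp add: mult_single)
    moreover have "Poly_Mapping.single 0 (1 / c) * msubst f p \<in> C k"
      using base(2) prime[of k] by (auto simp: poly_prime_iff intro: poly_ideal_mult)
    ultimately show False
      using prime[of k] by (simp add: poly_prime_iff)
  qed
next
  case (step j)
  have fV: "vars (f i) \<subseteq> V" if "i < k" for i
    using f(1)[OF that] prime[of "Suc i"] that by (auto simp: poly_prime_iff dest: poly_ideal_vars)
  \<comment> \<open>The inner induction is on a bound \<open>e\<close> for the exponent of
    \<open>X j\<close>: the quotient \<open>q\<close> satisfies the same hypotheses with
    \<open>e - 1\<close>, and for \<open>e = 0\<close> it has no terms.\<close>
  have "\<forall>m\<in>Poly_Mapping.keys p. Poly_Mapping.lookup m j \<le> e \<Longrightarrow>
    vars p \<subseteq> {j..<k} \<Longrightarrow> msubst f p \<in> C j \<Longrightarrow> p = 0" for e p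
  proof (induction e arbitrary: p rule: less_induct)
    case (less e)
    obtain p0 q where pq: "p = p0 + X j * q" "vars p0 \<subseteq> vars p - {j}" "vars q \<subseteq> vars p"
      "\<And>m. m \<in> Poly_Mapping.keys q \<Longrightarrow> m + Poly_Mapping.single j 1 \<in> Poly_Mapping.keys p"
      using split_variable[of p j] by blast
    have vq: "vars (msubst f q) \<subseteq> V"
      by (rule vars_msubst[of q "{j..<k}"]) (use pq(3) less.prems(2) fV in auto)
    have primes: "primeideal (C j) (poly_ring V)" "primeideal (C (Suc j)) (poly_ring V)"
      using prime step.hyps by auto
    then have ideal: "ideal (C (Suc j)) (poly_ring V)"
      by (simp add: poly_prime_iff)
    have "msubst f p - f j * msubst f q \<in> C (Suc j)"
      using less.prems(3) chain[of j] f(1)[of j] step.hyps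
      by (intro poly_ideal_diff[OF ideal] poly_ideal_mult_right[OF ideal] vq) auto
    moreover have "vars p0 \<subseteq> {Suc j..<k}"
      using pq(2) less.prems(2) by fastforce
    ultimately have "p0 = 0"
      using step.IH[of p0] pq(1) by (simp add: msubst_simps)
    then have "f j * msubst f q \<in> C j"
      using less.prems(3) pq(1) by (simp add: msubst_simps)
    then have qC: "msubst f q \<in> C j"
      using primes(1) vq fV[of j] f(2)[of j] step.hyps unfolding poly_prime_iff by blast
    have "q = 0"
    proof (cases "e = 0")
      case True
      have "Poly_Mapping.keys q = {}"
        using pq(4) less.prems(1) True by (fastforce simp: lookup_add)
      then show ?thesis by simp
    next
      case False
      show ?thesis
      proof (rule less.IH[of "e - 1"])
        show "\<forall>m\<in>Poly_Mapping.keys q. Poly_Mapping.lookup m j \<le> e - 1"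
          using pq(4) less.prems(1) by (fastforce simp: lookup_add)
      qed (use False qC pq(3) less.prems(2) in auto)
    qed
    with \<open>p0 = 0\<close> pq(1) show ?case by simp
  qed
  from this[of p "Max ((\<lambda>m. Poly_Mapping.lookup m j) ` Poly_Mapping.keys p)"] step.prems
  show ?case by simp
qed

section \<open>Counting monomials with bounded exponents\<close>

definition exponent_box :: "nat set \<Rightarrow> nat \<Rightarrow> (nat \<Rightarrow>\<^sub>0 nat) set"
  where "exponent_box A D = {m. Poly_Mapping.keys m \<subseteq> A \<and> (\<forall>i. Poly_Mapping.lookup m i \<le> D)}"

text \<open>Bounding each exponent separately, rather than the total degree, makes the count an
  exact power.\<close>

lemma exponent_box:
  assumes "finite A"
  shows finite_exponent_box: "finite (exponent_box A D)"
    and card_exponent_box: "card (exponent_box A D) = (D + 1) ^ card A"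
proof -
  have "bij_betw (\<lambda>m. restrict (Poly_Mapping.lookup m) A) (exponent_box A D) (A \<rightarrow>\<^sub>E {..D})"
  proof (rule bij_betw_byWitness[where f' = "\<lambda>g. \<Sum>i\<in>A. Poly_Mapping.single i (g i)"])
    have lookup: "Poly_Mapping.lookup (\<Sum>i\<in>A. Poly_Mapping.single i (g i)) j = (if j \<in> A then g j else 0)"
      for g :: "nat \<Rightarrow> nat" and j
      using assms by (simp add: lookup_sum lookup_single when_def)
    show "\<forall>m\<in>exponent_box A D. (\<Sum>i\<in>A. Poly_Mapping.single i (restrict (Poly_Mapping.lookup m) A i)) = m"
      by (auto intro!: poly_mapping_eqI simp: lookup exponent_box_def in_keys_iff)
    show "\<forall>g\<in>A \<rightarrow>\<^sub>E {..D}. restrict (Poly_Mapping.lookup (\<Sum>i\<in>A. Poly_Mapping.single i (g i))) A = g"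
      by (auto simp: lookup restrict_def PiE_def extensional_def fun_eq_iff)
    show "(\<lambda>m. restrict (Poly_Mapping.lookup m) A) ` exponent_box A D \<subseteq> A \<rightarrow>\<^sub>E {..D}"
      by (auto simp: exponent_box_def)
    show "(\<lambda>g. \<Sum>i\<in>A. Poly_Mapping.single i (g i)) ` (A \<rightarrow>\<^sub>E {..D}) \<subseteq> exponent_box A D"
      by (auto simp: exponent_box_def lookup in_keys_iff split: if_splits)
  qed
  moreover have "finite (A \<rightarrow>\<^sub>E {..D})" "card (A \<rightarrow>\<^sub>E {..D}) = (D + 1) ^ card A"
    using assms by (auto simp: finite_PiE card_PiE)
  ultimately show "finite (exponent_box A D)" "card (exponent_box A D) = (D + 1) ^ card A"
    by (auto simp: bij_betw_finite bij_betw_same_card)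
qed

definition exponents_le :: "nat \<Rightarrow> 'k::zero mpoly \<Rightarrow> bool"
  where "exponents_le d p \<longleftrightarrow> (\<forall>m\<in>Poly_Mapping.keys p. \<forall>i. Poly_Mapping.lookup m i \<le> d)"

lemma exponents_le_mult:
  assumes "exponents_le d p" "exponents_le e (q :: 'k::comm_ring_1 mpoly)"
  shows "exponents_le (d + e) (p * q)"
  using assms keys_mult[of p q]
  by (fastforce simp: exponents_le_def lookup_add intro: add_mono)

lemma exponents_le_1: "exponents_le d (1 :: 'k::comm_ring_1 mpoly)"
  by (simp add: exponents_le_def)

lemma exponents_le_power:
  "exponents_le d (p :: 'k::comm_ring_1 mpoly) \<Longrightarrow> exponents_le (e * d) (p ^ e)"
  by (induction e) (auto intro: exponents_le_1 exponents_le_mult)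

lemma exponents_le_prod:
  fixes g :: "'a \<Rightarrow> 'k::comm_ring_1 mpoly"
  assumes "\<And>a. a \<in> A \<Longrightarrow> exponents_le d (g a)"
  shows "exponents_le (card A * d) (prod g A)"
  using assms
  by (induction A rule: infinite_finite_induct) (auto intro: exponents_le_1 exponents_le_mult)

lemma exponents_le_ex: "\<exists>d. exponents_le d (p :: 'k::zero mpoly)"
proof -
  let ?E = "insert 0 (\<Union>m\<in>Poly_Mapping.keys p. Poly_Mapping.lookup m ` Poly_Mapping.keys m)"
  have "Poly_Mapping.lookup m i \<le> Max ?E" if "m \<in> Poly_Mapping.keys p" for m i
    using that by (cases "i \<in> Poly_Mapping.keys m") (auto intro!: Max_ge simp: in_keys_iff)
  then show ?thesis by (auto simp: exponents_le_def)
qed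

lemma exponents_le_mono: "exponents_le d p \<Longrightarrow> d \<le> e \<Longrightarrow> exponents_le e p"
  unfolding exponents_le_def by (meson order_trans)

lemma vector_space_mpoly:
  "vector_space (\<lambda>(c :: 'k::field) (p :: 'k mpoly). Poly_Mapping.single 0 c * p)"
proof
  fix a b :: 'k and p :: "'k mpoly"
  show "Poly_Mapping.single 0 a * (Poly_Mapping.single 0 b * p) = Poly_Mapping.single 0 (a * b) * p"
    using mult_single[of "0 :: nat \<Rightarrow>\<^sub>0 nat" a 0 b] by (simp flip: mult.assoc)
qed (simp_all add: algebra_simps single_add)

text \<open>An independent set inside the span of \<open>card T\<close> monomials has at most
  \<open>card T\<close> elements. Injectivity of \<open>v\<close> turns independence of the indexed
  family into independence of its image.\<close>

lemma card_le_card_monomials: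
  fixes v :: "'a \<Rightarrow> 'k::field mpoly"
  assumes fin: "finite B" "finite T" and inj: "inj_on v B"
    and keys: "\<And>b. b \<in> B \<Longrightarrow> Poly_Mapping.keys (v b) \<subseteq> T"
    and indep: "\<And>c b. (\<Sum>b\<in>B. Poly_Mapping.single 0 (c b) * v b) = 0 \<Longrightarrow> b \<in> B \<Longrightarrow> c b = 0"
  shows "card B \<le> card T"
proof -
  have expand: "p = (\<Sum>a\<in>Poly_Mapping.keys p. Poly_Mapping.single 0 (Poly_Mapping.lookup p a) * Poly_Mapping.single a 1)"
    for p :: "'k mpoly"
    by (simp add: mult_single poly_mapping_expand)
  interpret vector_space "\<lambda>(c :: 'k) (p :: 'k mpoly). Poly_Mapping.single 0 c * p"
    by (rule vector_space_mpoly)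
  have "independent (v ` B)"
  proof (rule independent_if_scalars_zero)
    fix u x assume u: "(\<Sum>x\<in>v ` B. Poly_Mapping.single 0 (u x) * x) = 0" and "x \<in> v ` B"
    then obtain b where b: "b \<in> B" "x = v b" by blast
    have "(\<Sum>b\<in>B. Poly_Mapping.single 0 (u (v b)) * v b) = 0"
      using u unfolding sum.reindex[OF inj] comp_def .
    from indep[OF this b(1)] show "u x = 0" unfolding b(2) .
  qed (rule finite_imageI[OF fin(1)])
  moreover have "v ` B \<subseteq> span ((\<lambda>m. Poly_Mapping.single m 1) ` T)"
  proof (rule image_subsetI)
    fix b assume "b \<in> B"
    then show "v b \<in> span ((\<lambda>m. Poly_Mapping.single m 1) ` T)"
      by (subst expand) (intro span_sum span_scale span_base imageI subsetD[OF keys])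
  qed
  ultimately have "card (v ` B) \<le> card ((\<lambda>m. Poly_Mapping.single m (1 :: 'k)) ` T)"
    using fin(2) by (intro independent_span_bound[THEN conjunct2] finite_imageI)
  then show ?thesis
    using card_image[OF inj] card_image_le[OF fin(2)] order_trans by metis
qed

text \<open>The products $f^m$ with exponents at most $D$ are $(D+1)^k$ independent vectors in a space
  spanned by $O(D^{|V|})$ monomials.\<close>

lemma algebraically_independent_le_card:
  fixes f :: "nat \<Rightarrow> 'k::field mpoly"
  assumes fin: "finite V" and V: "\<And>i. i < k \<Longrightarrow> vars (f i) \<subseteq> V"
    and indep: "\<And>p. vars p \<subseteq> {..<k} \<Longrightarrow> msubst f p = 0 \<Longrightarrow> p = 0"
  shows "k \<le> card V"
proof (rule ccontr)
  assume "\<not> k \<le> card V"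
  then have k: "card V < k" by simp
  obtain d where d: "exponents_le (d i) (f i)" for i
    using exponents_le_ex[of "f _"] by metis
  \<comment> \<open>The \<open>Suc\<close> keeps \<open>k * e\<close> positive, which absorbs the
    summand 1 in k D e + 1 \<le> k e (D + 1) below.\<close>
  define e where "e = Suc (\<Sum>i<k. d i)"
  have e: "exponents_le e (f i)" if "i < k" for i
    using member_le_sum[of i "{..<k}" d] that by (intro exponents_le_mono[OF d]) (auto simp: e_def)
  \<comment> \<open>Chosen so that (k e (D + 1))^|V| = D (D + 1)^|V|, which is less than (D +
    1)^(|V| + 1) and hence less than (D + 1)^k.\<close>
  define D where "D = (k * e) ^ card V"
  define B where "B = exponent_box {..<k} D"
  have finB: "finite B" by (simp add: B_def finite_exponent_box)
  have keysB: "vars (\<Sum>m\<in>B. Poly_Mapping.single m (c m)) \<subseteq> {..<k}" for c :: "_ \<Rightarrow> 'k"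
    by (intro vars_sum_closed order_trans[OF vars_single_subset]) (simp add: B_def exponent_box_def)
  have substB: "msubst f (\<Sum>m\<in>B. Poly_Mapping.single m (c m))
      = (\<Sum>m\<in>B. Poly_Mapping.single 0 (c m) * power_prod f m)" for c
    by (simp only: msubst_sum msubst_single)
  have indepB: "c m = 0"
    if "(\<Sum>m\<in>B. Poly_Mapping.single 0 (c m) * power_prod f m) = 0" "m \<in> B" for c m
  proof -
    have "(\<Sum>m\<in>B. Poly_Mapping.single m (c m)) = 0"
      by (rule indep[OF keysB]) (simp only: substB that(1))
    then have "(\<Sum>m'\<in>B. Poly_Mapping.lookup (Poly_Mapping.single m' (c m')) m) = 0"
      by (metis lookup_sum lookup_zero)
    with that(2) finB show ?thesis by (simp add: lookup_single when_def)
  qed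
  have inj: "inj_on (power_prod f) B"
  proof
    fix m m' assume m: "m \<in> B" "m' \<in> B" "power_prod f m = power_prod f m'"
    have "vars (Poly_Mapping.single m (1 :: 'k) - Poly_Mapping.single m' 1) \<subseteq> {..<k}"
      using m(1,2)
      by (intro vars_diff_closed order_trans[OF vars_single_subset]) (simp_all add: B_def exponent_box_def)
    then have "Poly_Mapping.single m (1 :: 'k) - Poly_Mapping.single m' 1 = 0"
      by (rule indep) (simp only: msubst_diff msubst_single m(3) diff_self)
    then have "Poly_Mapping.lookup (Poly_Mapping.single m (1 :: 'k)) m' = 1"
      by simp
    then show "m = m'" by (cases "m = m'") (simp_all add: lookup_single)
  qed
  have keys: "Poly_Mapping.keys (power_prod f m) \<subseteq> exponent_box V (k * (D * e))" if m: "m \<in> B" for m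
  proof
    let ?p = "power_prod f m"
    have pp: "?p = (\<Prod>i<k. f i ^ Poly_Mapping.lookup m i)"
      using m by (intro power_prod_superset) (auto simp: B_def exponent_box_def)
    have "exponents_le (D * e) (f i ^ Poly_Mapping.lookup m i)" if "i < k" for i
      using exponents_le_power[OF e[OF that], of "Poly_Mapping.lookup m i"]
      by (rule exponents_le_mono) (use m in \<open>simp add: B_def exponent_box_def\<close>)
    then have "exponents_le (k * (D * e)) ?p"
      using exponents_le_prod[of "{..<k}" "D * e" "\<lambda>i. f i ^ Poly_Mapping.lookup m i"] by (simp add: pp)
    moreover have "vars ?p \<subseteq> V"
      using vars_msubst[of "Poly_Mapping.single m 1" "{..<k}" f V] m V
      by (simp add: msubst_single B_def exponent_box_def vars_def)
    moreover fix a assume "a \<in> Poly_Mapping.keys ?p"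
    ultimately show "a \<in> exponent_box V (k * (D * e))"
      by (auto simp: exponents_le_def exponent_box_def vars_def)
  qed
  have "(D + 1) ^ k = card B"
    using card_exponent_box[of "{..<k}" D] by (simp add: B_def)
  also have "\<dots> \<le> card (exponent_box V (k * (D * e)))"
    using keys indepB by (rule card_le_card_monomials[OF finB finite_exponent_box[OF fin] inj])
  also have "\<dots> = (k * (D * e) + 1) ^ card V"
    by (rule card_exponent_box[OF fin])
  also have "\<dots> \<le> (k * e * (D + 1)) ^ card V"
    using k by (intro power_mono) (auto simp: algebra_simps e_def)
  also have "\<dots> = D * (D + 1) ^ card V"
    by (simp only: power_mult_distrib[of "k * e"] D_def)
  finally have "(D + 1) ^ k \<le> D * (D + 1) ^ card V" .
  moreover have "(D + 1) ^ Suc (card V) \<le> (D + 1) ^ k"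
    using k by (intro power_increasing) auto
  ultimately have "(D + 1) * (D + 1) ^ card V \<le> D * (D + 1) ^ card V"
    unfolding power_Suc by linarith
  then show False by (subst (asm) mult_le_cancel2) simp
qed

text \<open>Independence modulo \<open>C 0\<close> implies plain independence, since a relation
  takes the value 0 and \<open>C 0\<close> contains 0.\<close>

lemma prime_chain_length_le_card:
  fixes C :: "nat \<Rightarrow> 'k::field mpoly set"
  assumes "finite V" "\<And>i. i \<le> k \<Longrightarrow> primeideal (C i) (poly_ring V)" "\<And>i. i < k \<Longrightarrow> C i \<subset> C (Suc i)"
  shows "k \<le> card V"
proof -
  have "\<exists>f. \<forall>i<k. f i \<in> C (Suc i) \<and> f i \<notin> C i"
    using assms(3) by (intro choice) blast
  then obtain f where f: "\<And>i. i < k \<Longrightarrow> f i \<in> C (Suc i)" "\<And>i. i < k \<Longrightarrow> f i \<notin> C i"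
    by blast
  show ?thesis
  proof (rule algebraically_independent_le_card[OF assms(1)])
    show "vars (f i) \<subseteq> V" if "i < k" for i
      using f(1)[OF that] assms(2)[of "Suc i"] that
      by (auto simp: poly_prime_iff dest: poly_ideal_vars)
    show "p = 0" if "vars p \<subseteq> {..<k}" "msubst f p = 0" for p
    proof (rule chain_algebraically_independent[of k C V f 0 p])
      show "C i \<subseteq> C (Suc i)" if "i < k" for i
        using assms(3)[OF that] by blast
      show "msubst f p \<in> C 0"
        using assms(2)[of 0] that(2) by (auto simp: poly_prime_iff intro: poly_ideal_0)
    qed (use assms(2) f that(1) in \<open>auto simp: atLeast0LessThan\<close>)
  qed
qed

section \<open>The Hankel ideal as a toric ideal\<close>

text \<open>The kernel of a monomial map is spanned by differences of monomials with equal image: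
  subtracting a multiple of such a difference removes one term of \<open>p\<close>, so the number of
  terms decreases.\<close>

lemma monomial_kernel_subset:
  fixes f :: "nat \<Rightarrow> 'k::field mpoly"
  assumes f: "\<And>m. power_prod f m = Poly_Mapping.single (L m) 1"
    and J: "ideal J (poly_ring V)"
    and fiber: "\<And>m m'. Poly_Mapping.keys m \<subseteq> V \<Longrightarrow> Poly_Mapping.keys m' \<subseteq> V \<Longrightarrow> L m = L m' \<Longrightarrow>
      Poly_Mapping.single m 1 - Poly_Mapping.single m' 1 \<in> J"
  shows "msubst_kernel V f \<subseteq> J"
proof
  fix p assume "p \<in> msubst_kernel V f"
  then show "p \<in> J"
  proof (induction "card (Poly_Mapping.keys p)" arbitrary: p rule: less_induct)
    case less
    let ?K = "Poly_Mapping.keys p"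
    have p: "vars p \<subseteq> V" "msubst f p = 0"
      using less.prems by (auto simp: msubst_kernel_def)
    show ?case
    proof (cases "p = 0")
      case True
      then show ?thesis by (simp add: poly_ideal_0[OF J])
    next
      case False
      then obtain m where m: "m \<in> ?K"
        by (metis all_not_in_conv keys_eq_empty)
      have "msubst f p = (\<Sum>a\<in>?K. Poly_Mapping.single (L a) (Poly_Mapping.lookup p a))"
        by (simp add: msubst_def f mult_single)
      then have "(\<Sum>a\<in>?K. Poly_Mapping.lookup (Poly_Mapping.single (L a) (Poly_Mapping.lookup p a)) (L m)) = 0"
        using p(2) by (metis lookup_sum lookup_zero)
      \<comment> \<open>The coefficient of \<open>L m\<close> in the image vanishes, so the
        contribution of \<open>m\<close> must be cancelled by another term of the same
        fibre.\<close>
      then have "(\<Sum>a\<in>?K - {m}. Poly_Mapping.lookup (Poly_Mapping.single (L a) (Poly_Mapping.lookup p a)) (L m)) \<noteq> 0"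
        using m by (simp add: sum.remove[of ?K m] in_keys_iff add_eq_0_iff)
      then obtain m' where m': "m' \<in> ?K" "m' \<noteq> m" "L m' = L m"
        by (metis (no_types, lifting) DiffE insertI1 lookup_single_not_eq sum.neutral)
      define c where "c = Poly_Mapping.lookup p m"
      define d where "d = Poly_Mapping.single 0 c * (Poly_Mapping.single m 1 - Poly_Mapping.single m' 1)"
      have d': "d = Poly_Mapping.single m c - Poly_Mapping.single m' c"
        by (simp add: d_def mult_single right_diff_distrib)
      have "Poly_Mapping.keys m \<subseteq> V" "Poly_Mapping.keys m' \<subseteq> V"
        using p(1) m m'(1) by (auto simp: vars_def)
      then have dJ: "d \<in> J"
        using fiber[of m m'] m'(3) unfolding d_def by (intro poly_ideal_mult[OF J]) simp_all
      \<comment> \<open>Subtracting \<open>d\<close> deletes \<open>m\<close> and alters only the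
        coefficient of \<open>m'\<close>, which already occurs in \<open>p\<close>.\<close>
      have "Poly_Mapping.keys (p - d) \<subseteq> ?K - {m}"
      proof
        fix a assume "a \<in> Poly_Mapping.keys (p - d)"
        then show "a \<in> ?K - {m}"
          using m m' by (auto simp: d' in_keys_iff lookup_minus lookup_single when_def c_def split: if_splits)
      qed
      then have "Poly_Mapping.keys (p - d) \<subset> ?K"
        using m by auto
      then have "card (Poly_Mapping.keys (p - d)) < card ?K"
        by (simp add: psubset_card_mono)
      moreover have "p - d \<in> msubst_kernel V f"
        using p dJ m'(3) poly_ideal_vars[OF J dJ]
        by (simp add: msubst_kernel_def vars_diff_closed msubst_diff d' msubst_single f)
      ultimately have "p - d \<in> J"
        by (rule less.hyps)
      from poly_ideal_add[OF J this dJ] show ?thesis by simp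
    qed
  qed
qed

text \<open>As a multiset of indices, a monomial has degree \<open>size M\<close> and weight
  \<open>sum_mset M\<close>, and a single factor is split off by \<open>add_mset\<close>.\<close>

lemma power_prod_eq_prod_mset:
  obtains M where "set_mset M = Poly_Mapping.keys m" "\<And>f. power_prod f m = (\<Prod>i\<in>#M. f i)"
proof
  let ?M = "\<Sum>i\<in>Poly_Mapping.keys m. replicate_mset (Poly_Mapping.lookup m i) i"
  show "set_mset ?M = Poly_Mapping.keys m"
    by (auto simp: set_mset_sum in_keys_iff split: if_splits)
  have "(\<Prod>i\<in>#(\<Sum>i\<in>A. replicate_mset (Poly_Mapping.lookup m i) i). f i)
      = (\<Prod>i\<in>A. f i ^ Poly_Mapping.lookup m i)" if "finite A" for f :: "nat \<Rightarrow> 'a" and A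
    using that by (induction A) simp_all
  then show "power_prod f m = (\<Prod>i\<in>#?M. f i)" for f :: "nat \<Rightarrow> 'a"
    by (simp add: power_prod_def)
qed

lemma vars_prod_mset_X: "vars (\<Prod>i\<in>#M. X i :: 'k::comm_ring_1 mpoly) \<subseteq> set_mset M"
  by (induction M) (auto dest: subsetD[OF vars_mult])

lemma hankel_minor_vars:
  "1 \<le> i \<Longrightarrow> i < j \<Longrightarrow> j \<le> n \<Longrightarrow> vars (hankel_minor i j :: 'k::comm_ring_1 mpoly) \<subseteq> {1..n+1}"
  unfolding hankel_minor_def by (intro vars_diff_closed vars_mult_closed) auto

text \<open>Modulo the minors, $x_b x_c = x_{b-1} x_{c+1}$ for $b \le c$: the least index $b$ of a monomial
  is lowered to $a$ as long as some other index can be raised.\<close>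

lemma hankel_pull_out:
  fixes J :: "'k::comm_ring_1 mpoly set"
  assumes J: "ideal J (poly_ring {1..n+1})"
    and minors: "\<And>i j. 1 \<le> i \<Longrightarrow> i < j \<Longrightarrow> j \<le> n \<Longrightarrow> hankel_minor i j \<in> J"
    and "1 \<le> a" "a \<le> b" "set_mset M \<subseteq> {b..n+1}" "b \<in># M"
    and "sum_mset M \<le> a + (n + 1) * (size M - 1)"
  shows "\<exists>M'. set_mset M' \<subseteq> {1..n+1} \<and> size M = Suc (size M') \<and> sum_mset M = a + sum_mset M' \<and>
    (\<Prod>i\<in>#M. X i) - X a * (\<Prod>i\<in>#M'. X i) \<in> J"
  using assms(4-)
proof (induction b arbitrary: M rule: dec_induct)
  case base
  then obtain M' where "M = add_mset a M'"
    by (metis insert_DiffM)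
  with base assms(3) show ?case
    by (intro exI[of _ M']) (auto simp: poly_ideal_0[OF J])
next
  case (step b)
  obtain K where K: "M = add_mset (Suc b) K"
    using step.prems(2) by (metis insert_DiffM)
  \<comment> \<open>If every other index were the maximal n + 1, the sum would be b + 1 + (n +
    1)(size - 1), above the assumed bound because a \<le> b.\<close>
  have "\<exists>c\<in>#K. c \<le> n"
  proof (rule ccontr)
    assume "\<not> (\<exists>c\<in>#K. c \<le> n)"
    then have "\<forall>c\<in>#K. c = n + 1"
      using step.prems(1) K by fastforce
    then have "sum_mset K = (n + 1) * size K"
      by (induction K) auto
    then show False
      using step.prems(3) step.hyps K by simp
  qed
  then obtain c where c: "c \<in># K" "c \<le> n" by blast
  then obtain K' where K': "K = add_mset c K'"
    by (metis insert_DiffM)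
  \<comment> \<open>One index is lowered and another raised, so size and sum are unchanged; the
    products for \<open>M\<close> and \<open>?M2\<close> differ by a multiple of
    \<open>hankel_minor b c\<close>.\<close>
  let ?M2 = "add_mset b (add_mset (Suc c) K')"
  have bc: "Suc b \<le> c" using step.prems(1) K K' by auto
  have "set_mset ?M2 \<subseteq> {b..n+1}" "b \<in># ?M2" "sum_mset ?M2 \<le> a + (n + 1) * (size ?M2 - 1)"
    using step.prems bc c K K' by auto
  from step.IH[OF this] obtain M' where M': "set_mset M' \<subseteq> {1..n+1}" "size ?M2 = Suc (size M')"
    "sum_mset ?M2 = a + sum_mset M'" "(\<Prod>i\<in>#?M2. X i) - X a * (\<Prod>i\<in>#M'. X i) \<in> J"
    by blast
  have "vars (\<Prod>i\<in>#K'. X i :: 'k mpoly) \<subseteq> {1..n+1}"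
    using vars_prod_mset_X[where ?'k = 'k, of K'] step.prems(1) K K' by auto
  then have "hankel_minor b c * (\<Prod>i\<in>#K'. X i) \<in> J"
    using step.hyps assms(3) bc c by (intro poly_ideal_mult_right[OF J] minors) auto
  from poly_ideal_diff[OF J M'(4) this]
  have "(\<Prod>i\<in>#M. X i) - X a * (\<Prod>i\<in>#M'. X i) \<in> J"
    by (simp add: K K' hankel_minor_def algebra_simps)
  moreover have "size M = size ?M2" "sum_mset M = sum_mset ?M2"
    by (simp_all add: K K')
  ultimately show ?case using M' by metis
qed

text \<open>By symmetry let \<open>M\<close> have the smaller least index a. Then x_a can be pulled
  out of the monomial of \<open>N\<close> too, and the cofactors agree in size and sum but have one
  factor fewer.\<close>

lemma hankel_monomials_congruent:
  fixes J :: "'k::comm_ring_1 mpoly set"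
  assumes J: "ideal J (poly_ring {1..n+1})"
    and minors: "\<And>i j. 1 \<le> i \<Longrightarrow> i < j \<Longrightarrow> j \<le> n \<Longrightarrow> hankel_minor i j \<in> J"
    and "set_mset M \<subseteq> {1..n+1}" "set_mset N \<subseteq> {1..n+1}" "size M = size N" "sum_mset M = sum_mset N"
  shows "(\<Prod>i\<in>#M. X i) - (\<Prod>i\<in>#N. X i) \<in> J"
  using assms(3-)
proof (induction "size M" arbitrary: M N)
  case 0
  then show ?case by (simp add: poly_ideal_0[OF J])
next
  case (Suc s)
  have wlog: "(\<Prod>i\<in>#M. X i) - (\<Prod>i\<in>#N. X i) \<in> J"
    if MN: "Min_mset M \<le> Min_mset N" "size M = Suc s" "size N = Suc s" "sum_mset M = sum_mset N"
      "set_mset M \<subseteq> {1..n+1}" "set_mset N \<subseteq> {1..n+1}" for M N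
  proof -
    have ne: "M \<noteq> {#}" "N \<noteq> {#}" using MN(2,3) by auto
    let ?a = "Min_mset M" and ?b = "Min_mset N"
    have a: "?a \<in># M" and b: "?b \<in># N"
      using ne by (simp_all add: Min_in)
    obtain M0 where M0: "M = add_mset ?a M0"
      using a by (metis insert_DiffM)
    have "set_mset M0 \<subseteq> {1..n+1}"
      using M0 MN(5) by (metis insert_subset set_mset_add_mset_insert)
    then have "sum_mset M0 \<le> (n + 1) * size M0"
      by (induction M0) auto
    moreover have sizes: "size M0 = s" "sum_mset M = ?a + sum_mset M0"
      using MN(2) arg_cong[OF M0, of size] arg_cong[OF M0, of sum_mset] by simp_all
    \<comment> \<open>\<open>M\<close> itself supplies the bound: apart from a it has s indices,
      each at most n + 1, and \<open>N\<close> has the same sum.\<close>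
    ultimately have "sum_mset N \<le> ?a + (n + 1) * (size N - 1)"
      using MN by simp
    moreover have "set_mset N \<subseteq> {?b..n+1}"
      using MN(6) by auto
    moreover have "1 \<le> ?a" using a MN(5) by auto
    ultimately obtain N' where N': "set_mset N' \<subseteq> {1..n+1}" "size N = Suc (size N')"
      "sum_mset N = ?a + sum_mset N'" "(\<Prod>i\<in>#N. X i) - X ?a * (\<Prod>i\<in>#N'. X i) \<in> J"
      using hankel_pull_out[OF J, of ?a ?b N] minors MN(1) b by blast
    have "(\<Prod>i\<in>#M0. X i) - (\<Prod>i\<in>#N'. X i) \<in> J"
      using Suc.hyps(1)[of M0 N'] sizes N' MN \<open>set_mset M0 \<subseteq> {1..n+1}\<close> by simp
    then have "X ?a * ((\<Prod>i\<in>#M0. X i) - (\<Prod>i\<in>#N'. X i)) \<in> J"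
      using a MN(5) by (intro poly_ideal_mult[OF J]) auto
    from poly_ideal_diff[OF J this N'(4)]
    have "X ?a * (\<Prod>i\<in>#M0. X i) - (\<Prod>i\<in>#N. X i) \<in> J"
      by (simp add: algebra_simps)
    moreover have "(\<Prod>i\<in>#M. X i) = X ?a * (\<Prod>i\<in>#M0. X i :: 'k mpoly)"
      using arg_cong[OF M0, of "\<lambda>M. \<Prod>i\<in>#M. X i :: 'k mpoly"] by simp
    ultimately show ?thesis by simp
  qed
  show ?case
  proof (cases "Min_mset M \<le> Min_mset N")
    case True
    then show ?thesis using Suc by (intro wlog) simp_all
  next
    case False
    then have "(\<Prod>i\<in>#N. X i) - (\<Prod>i\<in>#M. X i) \<in> J"
      using Suc by (intro wlog) simp_all
    from poly_ideal_uminus[OF J this] show ?thesis by simp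
  qed
qed

text \<open>A monomial is sent to s^size t^sum, so its fibre consists of the monomials with the same
  size and index sum, and these are congruent modulo the minors.\<close>

lemma hankel_ideal_eq_kernel:
  "hankel_ideal n = msubst_kernel {1..n+1} (\<lambda>i. X 0 * X 1 ^ i :: 'k::field mpoly)"
    (is "?I = msubst_kernel ?V ?f")
proof
  let ?B = "{hankel_minor i j | i j. 1 \<le> i \<and> i < j \<and> j \<le> n} :: 'k mpoly set"
  have B: "vars b \<subseteq> ?V" if "b \<in> ?B" for b
    using that hankel_minor_vars by blast
  have I: "ideal ?I (poly_ring ?V)"
    unfolding hankel_ideal_def by (rule ideal_genideal_poly[OF B])
  have "ideal (msubst_kernel ?V ?f) (poly_ring ?V)"
    using primeideal_msubst_kernel[of ?V ?f] by (simp add: poly_prime_iff)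
  moreover have "?B \<subseteq> msubst_kernel ?V ?f"
  proof
    fix b assume b: "b \<in> ?B"
    then have "msubst ?f b = 0"
      by (auto simp: hankel_minor_def msubst_simps)
    with B[OF b] show "b \<in> msubst_kernel ?V ?f"
      by (simp add: msubst_kernel_def)
  qed
  ultimately show "?I \<subseteq> msubst_kernel ?V ?f"
    unfolding hankel_ideal_def by (subst genideal_poly_subset_iff[OF B])
  have minors: "hankel_minor i j \<in> ?I" if "1 \<le> i" "i < j" "j \<le> n" for i j
    unfolding hankel_ideal_def using that by (intro genideal_poly_self[OF B]) auto
  define L :: "nat multiset \<Rightarrow> nat \<Rightarrow>\<^sub>0 nat"
    where "L M = Poly_Mapping.single 0 (size M) + Poly_Mapping.single 1 (sum_mset M)" for M
  have L: "(\<Prod>i\<in>#M. ?f i) = Poly_Mapping.single (L M) 1" for M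
  proof -
    have "(\<Prod>i\<in>#M. ?f i) = X 0 ^ size M * X 1 ^ sum_mset M"
      by (induction M) (simp_all add: power_add)
    then show ?thesis
      by (simp add: X_power mult_single L_def)
  qed
  \<comment> \<open>The multiset must not depend on the substitution: \<open>mm m\<close> serves
    both for \<open>?f\<close> and for \<open>X\<close>.\<close>
  have "\<exists>M. set_mset M = Poly_Mapping.keys m \<and> (\<forall>f :: nat \<Rightarrow> 'k mpoly. power_prod f m = (\<Prod>i\<in>#M. f i))" for m
    using power_prod_eq_prod_mset[of m] by metis
  then obtain mm where mm: "\<And>m. set_mset (mm m) = Poly_Mapping.keys m"
    "\<And>m (f :: nat \<Rightarrow> 'k mpoly). power_prod f m = (\<Prod>i\<in>#mm m. f i)"
    by metis
  show "msubst_kernel ?V ?f \<subseteq> ?I"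
  proof (rule monomial_kernel_subset)
    show "power_prod ?f m = Poly_Mapping.single (L (mm m)) 1" for m
      by (simp only: mm(2) L)
    show "Poly_Mapping.single m 1 - Poly_Mapping.single m' 1 \<in> ?I"
      if "Poly_Mapping.keys m \<subseteq> ?V" "Poly_Mapping.keys m' \<subseteq> ?V" "L (mm m) = L (mm m')" for m m'
    proof -
      have "Poly_Mapping.lookup (L M) 0 = size M" "Poly_Mapping.lookup (L M) 1 = sum_mset M" for M
        by (simp_all add: L_def lookup_add lookup_single)
      then have "size (mm m) = size (mm m')" "sum_mset (mm m) = sum_mset (mm m')"
        using that(3) by metis+
      then show ?thesis
        using that(1,2) unfolding single_eq_power_prod mm(2)
        by (intro hankel_monomials_congruent[OF I minors]) (simp_all add: mm(1))
    qed
  qed (rule I)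
qed

lemma hankel_prime: "primeideal (hankel_ideal n :: 'k::field mpoly set) (S n)"
  unfolding hankel_ideal_eq_kernel by (rule primeideal_msubst_kernel)

lemma hankel_minor_mem: "1 \<le> i \<Longrightarrow> i < j \<Longrightarrow> j \<le> n \<Longrightarrow> hankel_minor i j \<in> (hankel_ideal n :: 'k::field mpoly set)"
  unfolding hankel_ideal_def using hankel_minor_vars by (intro genideal_poly_self) auto

lemma hankel_ideal_subset_iff:
  assumes "ideal J (S n)"
  shows "hankel_ideal n \<subseteq> J \<longleftrightarrow>
    (\<forall>i j. 1 \<le> i \<and> i < j \<and> j \<le> n \<longrightarrow> hankel_minor i j \<in> (J :: 'k::field mpoly set))"
  unfolding hankel_ideal_def using assms hankel_minor_vars
  by (subst genideal_poly_subset_iff) blast+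

text \<open>Both factors of x_j x_{i+1} lie among x_2,...,x_n, while x_i x_{j+1} avoids these
  variables only for i = 1 and j = n.\<close>

lemma hankel_minor_mem_variables:
  assumes J: "ideal J (S n)" and X: "X ` {2..n} \<subseteq> (J :: 'k::field mpoly set)"
    and ij: "1 \<le> i" "i < j" "j \<le> n" "(i, j) \<noteq> (1, n)"
  shows "hankel_minor i j \<in> J"
proof -
  have "X i * X (j + 1) \<in> J"
  proof (cases "i = 1")
    case True
    with X ij show ?thesis by (intro poly_ideal_mult[OF J]) auto
  next
    case False
    with X ij show ?thesis by (intro poly_ideal_mult_right[OF J]) auto
  qed
  moreover have "X j * X (i + 1) \<in> J"
    using X ij by (intro poly_ideal_mult[OF J]) auto
  ultimately show ?thesis
    unfolding hankel_minor_def by (rule poly_ideal_diff[OF J])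
qed


section \<open>Heights\<close>

text \<open>Replacing the top of the chain by the larger \<open>P\<close> keeps the inclusions
  strict, so one chain serves all primes above \<open>C k\<close>.\<close>

lemma prime_height_geI:
  assumes "\<And>i. i \<le> k \<Longrightarrow> primeideal (C i) R" "\<And>i. i < k \<Longrightarrow> C i \<subset> C (Suc i)"
    and "C k \<subseteq> P" "primeideal P R"
  shows "enat k \<le> prime_height R P"
proof -
  let ?D = "\<lambda>i. if i < k then C i else P"
  have "C i \<subset> P" if "i < k" "Suc i = k" for i
    using assms(2)[OF that(1)] assms(3) that(2) by blast
  then have "\<forall>i<k. ?D i \<subset> ?D (Suc i)"
    using assms(2) by (simp add: not_less Suc_leI le_antisym)
  moreover have "\<forall>i\<le>k. primeideal (?D i) R" "?D k = P"
    using assms(1,4) by simp_all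
  ultimately have "enat k \<in> {enat k | k C. (\<forall>i\<le>k. primeideal (C i) R) \<and> (\<forall>i<k. C i \<subset> C (Suc i)) \<and> C k = P}"
    by (intro CollectI exI[of _ k] exI[of _ ?D] conjI refl)
  then show ?thesis
    unfolding prime_height_def by (rule Sup_upper)
qed

lemma prime_height_leI:
  assumes "\<And>k C. (\<And>i. i \<le> k \<Longrightarrow> primeideal (C i) R) \<Longrightarrow> (\<And>i. i < k \<Longrightarrow> C i \<subset> C (Suc i)) \<Longrightarrow>
    C k = P \<Longrightarrow> k \<le> N"
  shows "prime_height R P \<le> enat N"
  unfolding prime_height_def
proof (rule Sup_least)
  fix x
  assume "x \<in> {enat k | k C. (\<forall>i\<le>k. primeideal (C i) R) \<and> (\<forall>i<k. C i \<subset> C (Suc i)) \<and> C k = P}"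
  then obtain k C where "x = enat k" "\<forall>i\<le>k. primeideal (C i) R" "\<forall>i<k. C i \<subset> C (Suc i)" "C k = P"
    by blast
  then show "x \<le> enat N"
    using assms[of k C] by simp
qed

text \<open>The images of the variables with indices at most $k+1$ lie on the rational normal curve, so
  the kernels for $k = 1, \ldots, n$ are the Hankel ideals of the first $k$ columns.\<close>

definition curve_subst :: "nat \<Rightarrow> nat \<Rightarrow> 'k::field mpoly"
  where "curve_subst k i = (if i \<le> k + 1 then X 0 * X 1 ^ i else X i)"

lemma curve_kernel_psubset:
  assumes "1 \<le> k" "k < n"
  shows "msubst_kernel {1..n+1} (curve_subst k) \<subset> (msubst_kernel {1..n+1} (curve_subst (Suc k)) :: 'k::field mpoly set)"
proof -
  \<comment> \<open>Placing x_{k+2} on the curve leads from one substitution to the next, hence the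
    inclusion of kernels. As k + 2 \<ge> 3, the parameters \<open>X 0\<close> and \<open>X 1\<close>
    are left fixed.\<close>
  let ?g = "\<lambda>i. if i = k + 2 then X 0 * X 1 ^ (k + 2) else X i :: 'k mpoly"
  have "msubst ?g (curve_subst k i) = curve_subst (Suc k) i" if "i \<in> {1..n+1}" for i
    using assms that by (cases "i = k + 2") (auto simp: curve_subst_def msubst_simps)
  then have "msubst ?g (msubst (curve_subst k) p) = msubst (curve_subst (Suc k)) p"
    if "vars p \<subseteq> {1..n+1}" for p
    unfolding msubst_msubst by (rule msubst_cong[OF that])
  then have "msubst_kernel {1..n+1} (curve_subst k) \<subseteq> (msubst_kernel {1..n+1} (curve_subst (Suc k)) :: 'k mpoly set)"
    unfolding msubst_kernel_def by (smt (verit, best) mem_Collect_eq msubst_0 subsetI)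
  moreover have "hankel_minor k (k + 1) \<in> (msubst_kernel {1..n+1} (curve_subst (Suc k)) :: 'k mpoly set)"
    using hankel_minor_vars[of k "k + 1" n, where ?'k = 'k] assms
    by (simp add: msubst_kernel_def) (simp add: hankel_minor_def msubst_simps curve_subst_def power_add)
  moreover have "hankel_minor k (k + 1) \<notin> (msubst_kernel {1..n+1} (curve_subst k) :: 'k mpoly set)"
  proof
    assume "hankel_minor k (k + 1) \<in> (msubst_kernel {1..n+1} (curve_subst k) :: 'k mpoly set)"
    then have "msubst (curve_subst k) (hankel_minor k (k + 1)) = (0 :: 'k mpoly)"
      by (simp add: msubst_kernel_def)
    \<comment> \<open>Evaluation at x_{k+2} = 0 and 1 elsewhere sends the image of x_k x_{k+2} -
      x_{k+1}^2 to -1.\<close>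
    then have "msubst (\<lambda>i. if i = k + 2 then 0 else 1) (msubst (curve_subst k) (hankel_minor k (k + 1))) = (0 :: 'k mpoly)"
      by simp
    then show False
      using assms by (simp add: hankel_minor_def msubst_simps curve_subst_def)
  qed
  ultimately show ?thesis by blast
qed

lemma height_hankel_lower:
  assumes "1 \<le> n" "primeideal P (S n)" "hankel_ideal n \<subseteq> (P :: 'k::field mpoly set)"
  shows "enat (n - 1) \<le> prime_height (S n) P"
proof (rule prime_height_geI)
  \<comment> \<open>The shift makes the chain start at \<open>curve_subst 1\<close>, with kernel 0,
    and reach \<open>curve_subst n\<close> after n - 1 steps.\<close>
  let ?C = "\<lambda>k. msubst_kernel {1..n+1} (curve_subst (Suc k)) :: 'k mpoly set"
  show "primeideal (?C i) (S n)" for i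
    by (rule primeideal_msubst_kernel)
  show "?C i \<subset> ?C (Suc i)" if "i < n - 1" for i
    using that by (intro curve_kernel_psubset) auto
  have "?C (n - 1) = hankel_ideal n"
    using assms(1) unfolding hankel_ideal_eq_kernel msubst_kernel_def
    by (intro Collect_cong conj_cong refl arg_cong[where f = "\<lambda>p. p = 0"] msubst_cong[of _ "{1..n+1}"])
      (auto simp: curve_subst_def)
  with assms(3) show "?C (n - 1) \<subseteq> P" by simp
qed fact

lemma height_variables_lower:
  assumes "1 \<le> n" "primeideal P (S n)" "Idl\<^bsub>S n\<^esub> (X ` {2..n}) \<subseteq> (P :: 'k::field mpoly set)"
  shows "enat (n - 1) \<le> prime_height (S n) P"
proof (rule prime_height_geI)
  \<comment> \<open>The range \<open>{2..k + 1}\<close> is empty for \<open>k = 0\<close>, so the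
    chain starts at the zero ideal.\<close>
  let ?C = "\<lambda>k. Idl\<^bsub>S n\<^esub> (X ` {2..k + 1}) :: 'k mpoly set"
  show "primeideal (?C i) (S n)" if "i \<le> n - 1" for i
    using that by (intro primeideal_variable_ideal) auto
  show "?C i \<subset> ?C (Suc i)" if "i < n - 1" for i
    using that by (intro variable_ideal_psubset) auto
  show "?C (n - 1) \<subseteq> P"
    using assms(1,3) by simp
qed fact

lemma height_hankel_upper:
  assumes "1 \<le> n"
  shows "prime_height (S n) (hankel_ideal n :: 'k::field mpoly set) \<le> enat (n - 1)"
proof (rule prime_height_leI)
  fix k and C :: "nat \<Rightarrow> 'k mpoly set"
  assume C: "\<And>i. i \<le> k \<Longrightarrow> primeideal (C i) (S n)" "\<And>i. i < k \<Longrightarrow> C i \<subset> C (Suc i)" "C k = hankel_ideal n"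
  let ?P = "Idl\<^bsub>S n\<^esub> (X ` {1..n}) :: 'k mpoly set"
  let ?Q = "Idl\<^bsub>S n\<^esub> (X ` {1..n+1}) :: 'k mpoly set"
  have P: "primeideal ?P (S n)" and Q: "primeideal ?Q (S n)"
    by (intro primeideal_variable_ideal; auto)+
  have "hankel_minor i j \<in> ?P" if "1 \<le> i" "i < j" "j \<le> n" for i j
  proof -
    have J: "ideal ?P (S n)" using P by (simp add: poly_prime_iff)
    have "X i \<in> ?P" "X j \<in> ?P"
      using that by (subst X_mem_variable_ideal_iff; auto)+
    with that show ?thesis
      unfolding hankel_minor_def
      by (intro poly_ideal_diff[OF J] poly_ideal_mult_right[OF J]) auto
  qed
  then have "hankel_ideal n \<subseteq> ?P"
    using P by (subst hankel_ideal_subset_iff) (auto simp: poly_prime_iff)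
  moreover have "X 1 \<in> ?P"
    using assms by (subst X_mem_variable_ideal_iff) auto
  moreover have "X 1 \<notin> (hankel_ideal n :: 'k mpoly set)"
    by (simp add: hankel_ideal_eq_kernel msubst_kernel_def)
  ultimately have "hankel_ideal n \<subset> ?P" by blast
  moreover have "?P \<subset> ?Q"
    by (rule variable_ideal_psubset) auto
  moreover define D where "D i = (if i \<le> k then C i else if i = k + 1 then ?P else ?Q)" for i
  ultimately have "D i \<subset> D (Suc i)" if "i < k + 2" for i
    using that C(2)[of i] C(3) by (cases "i < k"; cases "i = k") (auto simp: D_def)
  moreover have "primeideal (D i) (S n)" for i
    using C(1) P Q by (simp add: D_def)
  ultimately have "k + 2 \<le> card {1..n+1}"
    by (intro prime_chain_length_le_card[of _ _ D]) simp_all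
  then show "k \<le> n - 1" by simp
qed


section \<open>Minimal primes\<close>

text \<open>Modulo \<open>P\<close>, x_{j+1}^2 equals x_j x_{j+2}, so a variable in \<open>P\<close>
  forces its neighbours in, up to x_2 and x_n; the endpoints x_1 and x_{n+1} are not
  reached.\<close>

lemma prime_over_path:
  fixes P :: "'k::field mpoly set"
  assumes P: "primeideal P (S n)"
    and minors: "\<And>i. 1 \<le> i \<Longrightarrow> i < n \<Longrightarrow> hankel_minor i (i + 1) \<in> P"
  shows "X ` {2..n} \<subseteq> P \<or> hankel_ideal n \<subseteq> P"
proof (cases "\<exists>i\<in>{1..n+1}. X i \<in> P")
  case True
  then obtain i where i: "1 \<le> i" "i \<le> n + 1" "X i \<in> P" by auto
  have J: "ideal P (S n)" using P by (simp add: poly_prime_iff)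
  have middle: "X (j + 1) \<in> P" if "X j \<in> P \<or> X (j + 2) \<in> P" "1 \<le> j" "j < n" for j
  proof -
    have "X j * X (j + 2) \<in> P"
      using that by (auto intro: poly_ideal_mult[OF J] poly_ideal_mult_right[OF J])
    from poly_ideal_diff[OF J this minors[OF that(2,3)]]
    have "X (j + 1) ^ 2 \<in> P"
      by (simp add: hankel_minor_def power2_eq_square)
    from poly_prime_power[OF P _ this] that(2,3) show ?thesis
      by simp
  qed
  have "X j \<in> P" if "2 \<le> j" "j \<le> n" for j
  proof (cases "i \<le> j")
    case True
    then show ?thesis using that(2)
    proof (induction j rule: dec_induct)
      case (step j)
      then show ?case using middle[of j] i(1) by simp
    qed (rule i(3))
  next
    case False
    then have "j \<le> i" by simp
    then show ?thesis using that(1)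
    proof (induction j rule: inc_induct)
      case (step j)
      then show ?case using middle[of "j - 1"] i(2) by (simp add: numeral_2_eq_2 Suc_diff_le)
    qed (rule i(3))
  qed
  then show ?thesis by auto
next
  case False
  have J: "ideal P (S n)" using P by (simp add: poly_prime_iff)
  have "hankel_minor i j \<in> P" if i: "1 \<le> i" and "i < j" "j \<le> n" for i j
    using Suc_leI[OF that(2)] that(3)
  proof (induction j rule: dec_induct)
    case base
    then show ?case using minors[of i] i by simp
  next
    case (step j)
    \<comment> \<open>Equality of the ratios x_{i+1}/x_i, x_{j+1}/x_j and x_{j+2}/x_{j+1}, written
      without division; the factor \<open>X j\<close> is then cancelled because it is not in
      \<open>P\<close>.\<close>
    have "X j * hankel_minor i (Suc j) = X i * hankel_minor j (j + 1) + X (j + 1) * (hankel_minor i j :: 'k mpoly)"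
      by (simp add: hankel_minor_def algebra_simps)
    also have "\<dots> \<in> P"
      using step i by (intro poly_ideal_add[OF J] poly_ideal_mult[OF J] minors step.IH) auto
    finally have "X j \<in> P \<or> hankel_minor i (Suc j) \<in> P"
      using P step i hankel_minor_vars[of i "Suc j" n, where ?'k = 'k] unfolding poly_prime_iff by simp
    with False step i show ?case by auto
  qed
  then have "hankel_ideal n \<subseteq> P"
    by (subst hankel_ideal_subset_iff[OF J]) blast
  then show ?thesis ..
qed

text \<open>The last premise admits \<open>A = B\<close>, which covers n = 1 and also yields the
  version with a single minimal prime.\<close>

lemma minimal_primes_eq_pair:
  assumes "primeideal A R" "I \<subseteq> A" "primeideal B R" "I \<subseteq> B"
    and "\<And>Q. primeideal Q R \<Longrightarrow> I \<subseteq> Q \<Longrightarrow> A \<subseteq> Q \<or> B \<subseteq> Q"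
    and "A \<subseteq> B \<or> B \<subseteq> A \<Longrightarrow> A = B"
  shows "minimal_primes R I = {A, B}"
proof (intro equalityI subsetI)
  fix P assume "P \<in> minimal_primes R I"
  then have P: "primeideal P R" "I \<subseteq> P"
    and minimal: "\<And>Q. primeideal Q R \<Longrightarrow> I \<subseteq> Q \<Longrightarrow> Q \<subseteq> P \<Longrightarrow> Q = P"
    by (simp_all add: minimal_primes_def)
  from assms(5)[OF P] show "P \<in> {A, B}"
    using minimal[OF assms(1,2)] minimal[OF assms(3,4)] by blast
next
  fix P assume P: "P \<in> {A, B}"
  have "Q = P" if "primeideal Q R" "I \<subseteq> Q" "Q \<subseteq> P" for Q
    using assms(5)[OF that(1,2)] assms(6) P that(3) by blast
  with P assms(1-4) show "P \<in> minimal_primes R I"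
    by (auto simp: minimal_primes_def)
qed

lemma minimal_primes_eq_singleton:
  assumes "primeideal A R" "I \<subseteq> A" "\<And>Q. primeideal Q R \<Longrightarrow> I \<subseteq> Q \<Longrightarrow> A \<subseteq> Q"
  shows "minimal_primes R I = {A}"
  using minimal_primes_eq_pair[OF assms(1,2) assms(1,2)] assms(3) by simp

text \<open>For n \<le> 1 both ideals have no generators. For n \<ge> 3 neither contains the other:
  x_2 maps to s t^2, which is not 0, and modulo (x_2,...,x_n) the minor of columns 1 and n is x_1
  x_{n+1}.\<close>

lemma hankel_variables_incomparable:
  assumes "n \<noteq> 2"
    and sub: "hankel_ideal n \<subseteq> (Idl\<^bsub>S n\<^esub> (X ` {2..n}) :: 'k::field mpoly set) \<or>
      (Idl\<^bsub>S n\<^esub> (X ` {2..n}) :: 'k mpoly set) \<subseteq> hankel_ideal n"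
  shows "hankel_ideal n = (Idl\<^bsub>S n\<^esub> (X ` {2..n}) :: 'k mpoly set)"
proof (cases "n \<le> 1")
  case True
  then have "{hankel_minor i j | i j. 1 \<le> i \<and> i < j \<and> j \<le> n} = ({} :: 'k mpoly set)" "{2..n} = {}"
    by auto
  then show ?thesis unfolding hankel_ideal_def by (simp only: image_empty)
next
  case False
  define Y where "Y = (Idl\<^bsub>S n\<^esub> (X ` {2..n}) :: 'k mpoly set)"
  have n: "3 \<le> n" using False assms(1) by simp
  have Y: "primeideal Y (S n)"
    unfolding Y_def by (rule primeideal_variable_ideal) auto
  then have J: "ideal Y (S n)" by (rule primeideal.axioms(1))
  have mem: "X i \<in> Y \<longleftrightarrow> i \<in> {2..n}" if "i \<in> {1..n+1}" for i
    using that unfolding Y_def by (intro X_mem_variable_ideal_iff) auto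
  have "hankel_minor 1 n \<notin> Y"
  proof
    assume minor: "hankel_minor 1 n \<in> Y"
    have "X n * X 2 \<in> Y"
      using n by (intro poly_ideal_mult[OF J]) (simp_all add: mem)
    from poly_ideal_add[OF J minor this] have "X 1 * X (n + 1) \<in> Y"
      by (simp add: hankel_minor_def numeral_2_eq_2)
    then have "X 1 \<in> Y \<or> X (n + 1) \<in> Y"
      using Y unfolding poly_prime_iff by simp
    then show False using n by (simp add: mem)
  qed
  moreover have "hankel_minor 1 n \<in> (hankel_ideal n :: 'k mpoly set)"
    using n by (intro hankel_minor_mem) auto
  moreover have "X 2 \<in> Y" "X 2 \<notin> (hankel_ideal n :: 'k mpoly set)"
    using n by (simp_all add: mem hankel_ideal_eq_kernel msubst_kernel_def)
  ultimately show ?thesis using sub unfolding Y_def by blast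
qed

theorem theorem2p2:
  fixes n :: nat and G :: "nat pair_pre_digraph"
  assumes "pair_graph G"
    and "pverts G = {1..n}"
    and "connected (with_proj G)"
  shows "(labeled_Hamiltonian n G \<longrightarrow>
            minimal_primes (S n :: 'k::field mpoly ring) (hankel_edge_ideal n G)
              = {hankel_ideal n}) \<and>
         (labeled_semi_Hamiltonian n G \<longrightarrow>
            minimal_primes (S n :: 'k mpoly ring) (hankel_edge_ideal n G)
              = {hankel_ideal n, Idl\<^bsub>S n\<^esub> (X ` {2..n})}) \<and>
         (labeled_Hamiltonian n G \<or> labeled_semi_Hamiltonian n G \<longrightarrow>
            height (S n :: 'k mpoly ring) (hankel_edge_ideal n G) = enat (n - 1))"
proof -
  let ?E = "hankel_edge_ideal n G :: 'k mpoly set"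
  let ?I = "hankel_ideal n :: 'k mpoly set"
  let ?Y = "Idl\<^bsub>S n\<^esub> (X ` {2..n}) :: 'k mpoly set"
  have "verts (with_proj G) \<noteq> {}"
    using assms(3) by (auto simp: connected_def strongly_connected_def)
  then have n: "1 \<le> n" using assms(2) by (cases n) auto
  interpret pair_graph G by (rule assms(1))
  have arcs: "i \<noteq> j" "i \<in> {1..n}" "j \<in> {1..n}" if "(i, j) \<in> parcs G" for i j
    using that pair_no_loops[OF that] in_arcsD1[OF that] in_arcsD2[OF that] assms(2) by auto
  have E_subset_iff: "?E \<subseteq> J \<longleftrightarrow> (\<forall>i j. i < j \<and> (i, j) \<in> parcs G \<longrightarrow> hankel_minor i j \<in> J)"
    if "ideal J (S n)" for J
    unfolding hankel_edge_ideal_def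
    by (subst genideal_poly_subset_iff[OF _ that]) (use arcs hankel_minor_vars in fastforce)+
  have I: "primeideal ?I (S n)" by (rule hankel_prime)
  have Y: "primeideal ?Y (S n)" by (rule primeideal_variable_ideal) auto
  have XY: "X ` {2..n} \<subseteq> ?Y"
    by (auto simp: X_mem_variable_ideal_iff)
  have EI: "?E \<subseteq> ?I"
    using arcs by (auto simp: E_subset_iff[OF primeideal.axioms(1)[OF I]] intro!: hankel_minor_mem)
  have Y_subset_iff: "?Y \<subseteq> P \<longleftrightarrow> X ` {2..n} \<subseteq> P" if "primeideal P (S n)" for P
    using variable_ideal_subset_iff[OF _ primeideal.axioms(1)[OF that], of "{2..n}"] by auto
  \<comment> \<open>This dichotomy is used for both lists of minimal primes and for the lower bound
    on the height.\<close>
  have over: "?Y \<subseteq> P \<or> ?I \<subseteq> P"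
    if "primeideal P (S n)" "?E \<subseteq> P" and H: "labeled_Hamiltonian n G \<or> labeled_semi_Hamiltonian n G" for P
  proof -
    have "(i, i + 1) \<in> parcs G" if "1 \<le> i" "i < n" for i
      using H that
      by (auto simp: labeled_Hamiltonian_def labeled_semi_Hamiltonian_def subgraph_def
          cycle_graph_def path_graph_def)
    then show ?thesis
      using that(2) unfolding Y_subset_iff[OF that(1)] E_subset_iff[OF primeideal.axioms(1)[OF that(1)]]
      by (intro prime_over_path[OF that(1)]) auto
  qed
  have Hamiltonian: "minimal_primes (S n) ?E = {?I}" if H: "labeled_Hamiltonian n G"
  proof (rule minimal_primes_eq_singleton[OF I EI])
    fix P assume P: "primeideal P (S n)" "?E \<subseteq> P"
    then have J: "ideal P (S n)" by (simp add: primeideal.axioms(1))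
    have "(1, n) \<in> parcs G" "1 < n"
      using H by (auto simp: labeled_Hamiltonian_def subgraph_def cycle_graph_def)
    then have "hankel_minor 1 n \<in> P"
      using P(2) by (simp add: E_subset_iff[OF J])
    \<comment> \<open>The minor of the edge {1,n} is the only one not already forced by x_2,...,x_n,
      so the second alternative falls under the first.\<close>
    then have "?I \<subseteq> P" if "?Y \<subseteq> P"
      using hankel_minor_mem_variables[OF J] that
      unfolding Y_subset_iff[OF P(1)] hankel_ideal_subset_iff[OF J] by blast
    then show "?I \<subseteq> P"
      using over[OF P] H by blast
  qed
  have semi_Hamiltonian: "minimal_primes (S n) ?E = {?I, ?Y}" if H: "labeled_semi_Hamiltonian n G"
  proof (rule minimal_primes_eq_pair[OF I EI Y])
    \<comment> \<open>For n = 2 these two facts contradict each other, which gives the premise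
      \<open>n \<noteq> 2\<close> of the comparison below.\<close>
    have arc: "(1, n) \<notin> parcs G" and path: "(1, 2) \<in> parcs G" if "2 \<le> n"
      using H that by (auto simp: labeled_semi_Hamiltonian_def subgraph_def path_graph_def)
    show "?E \<subseteq> ?Y"
      unfolding E_subset_iff[OF primeideal.axioms(1)[OF Y]]
    proof (intro allI impI)
      fix i j assume "i < j \<and> (i, j) \<in> parcs G"
      with arcs[of i j] H have "1 \<le> i" "i < j" "j \<le> n" "(i, j) \<noteq> (1, n)"
        by (auto simp: labeled_semi_Hamiltonian_def)
      then show "hankel_minor i j \<in> ?Y"
        by (rule hankel_minor_mem_variables[OF primeideal.axioms(1)[OF Y] XY])
    qed
    show "?I \<subseteq> P \<or> ?Y \<subseteq> P" if "primeideal P (S n)" "?E \<subseteq> P" for P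
      using over[OF that] H by blast
    show "?I = ?Y" if "?I \<subseteq> ?Y \<or> ?Y \<subseteq> ?I"
      using that arc path by (intro hankel_variables_incomparable) auto
  qed
  have "height (S n) ?E = enat (n - 1)" if H: "labeled_Hamiltonian n G \<or> labeled_semi_Hamiltonian n G"
  proof (rule antisym)
    have "height (S n) ?E \<le> prime_height (S n) ?I"
      unfolding height_def by (rule INF_lower) (use I EI in blast)
    also have "\<dots> \<le> enat (n - 1)"
      by (rule height_hankel_upper[OF n])
    finally show "height (S n) ?E \<le> enat (n - 1)" .
    show "enat (n - 1) \<le> height (S n) ?E"
      unfolding height_def
      using over H height_hankel_lower[OF n] height_variables_lower[OF n]
      by (intro INF_greatest) blast
  qed
  with Hamiltonian semi_Hamiltonian show ?thesis by blast
qed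

end
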